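(* Let $(M^m_p,g_M)$ and $(N^n_q,g_N)$ be pseudo-Riemannian manifolds. A smooth map $\varphi:M\rightarrow N$ is a Chern--Federer map if and only if $$\begin{aligned}0=\sum_{i,j}\varepsilon_i\varepsilon_j\Big\{&(\nabla R^N)\big(d\varphi(e_i),d\varphi(e_i),d\varphi(e_j)\big)d\varphi(e_j)-(\widetilde{\nabla}d\varphi)\big(e_i,R^M(e_i,e_j)e_j\big)\\&-d\varphi\big((\nabla R^M)(e_i,e_i,e_j)e_j\big)+2R^N\big((\widetilde{\nabla}d\varphi)(e_i,e_i),d\varphi(e_j)\big)d\varphi(e_j)\\&+2R^N\big(d\varphi(e_i),(\widetilde{\nabla}d\varphi)(e_i,e_j)\big)d\varphi(e_j)\Big\},\end{aligned}$$ where $\{e_i\}_{i=1}^m$ is a local pseudo-orthonormal frame field of $(M^m_p,g_M)$.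
   Context: $M^m_p$ denotes a manifold of dimension $m$ whose metric has index $p$ (similarly $N^n_q$). A local pseudo-orthonormal frame satisfies $g_M(e_i,e_j)=\varepsilon_i\delta_{ij}$ with $\varepsilon_1=\cdots=\varepsilon_p=-1$, $\varepsilon_{p+1}=\cdots=\varepsilon_m=1$. $\nabla$ is the Levi-Civita connection and $\overline{\nabla}$ the induced (pull-back) connection on $\varphi^{-1}TN$. For vector fields $X,Y,Z,W$ on $M$: $(\widetilde{\nabla}d\varphi)(X,Y):=\overline{\nabla}_X(d\varphi(Y))-d\varphi(\nabla_XY)$; $(\widetilde{\nabla}^2d\varphi)(X,Y,Z):=\overline{\nabla}_X\big((\widetilde{\nabla}d\varphi)(Y,Z)\big)-(\widetilde{\nabla}d\varphi)(\nabla_XY,Z)-(\widetilde{\nabla}d\varphi)(Y,\nabla_XZ)$; $(\widetilde{\nabla}^3d\varphi)(X,Y,Z,W):=\overline{\nabla}_X\big((\widetilde{\nabla}^2d\varphi)(Y,Z,W)\big)-(\widetilde{\nabla}^2d\varphi)(\nabla_XY,Z,W)-(\widetilde{\nabla}^2d\varphi)(Y,\nabla_XZ,W)-(\widetilde{\nabla}^2d\varphi)(Y,Z,\nabla_XW)$. $R^M,R^N$ are the curvature tensors of $M,N$, with $R(X,Y)=\nabla_X\nabla_Y-\nabla_Y\nabla_X-\nabla_{[X,Y]}$, and $(\nabla R)(X,Y,Z)W:=(\nabla_XR)(Y,Z)W$ is the covariant derivative of $R$. Set $$W_1(\varphi):=\sum_{i,j}\varepsilon_i\varepsilon_j\big\{(\widetilde{\nabla}^3d\varphi)(e_i,e_j,e_i,e_j)+R^N\big((\widetilde{\nabla}d\varphi)(e_i,e_j),d\varphi(e_i)\big)d\varphi(e_j)\big\},$$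 $$W_2(\varphi):=\sum_{i,j}\varepsilon_i\varepsilon_j\big\{(\widetilde{\nabla}^3d\varphi)(e_i,e_i,e_j,e_j)+R^N\big((\widetilde{\nabla}d\varphi)(e_i,e_i),d\varphi(e_j)\big)d\varphi(e_j)\big\}.$$ A smooth map $\varphi$ is called a Chern--Federer map if $W_2(\varphi)-W_1(\varphi)=0$ (this is the Euler--Lagrange equation of the Chern--Federer energy functional $I^{\mathrm{CF}}(\varphi)=\int_M\{\langle\mathrm{tr}_{g_M}\widetilde{\nabla}d\varphi,\mathrm{tr}_{g_M}\widetilde{\nabla}d\varphi\rangle-\langle\widetilde{\nabla}d\varphi,\widetilde{\nabla}d\varphi\rangle\}d\mu_{g_M}$). *)

theory Defs
  imports "HOL-Analysis.Analysis"
begin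

section \<open>Smooth functions between Euclidean spaces\<close>

text \<open>Only used for open \<open>S\<close>; the derivatives are therefore taken in the whole space.\<close>

primrec Ck_on :: "nat \<Rightarrow> ('e::euclidean_space \<Rightarrow> 'f::euclidean_space) \<Rightarrow> 'e set \<Rightarrow> bool"
  where
    "Ck_on 0 f S \<longleftrightarrow> continuous_on S f"
  | "Ck_on (Suc k) f S \<longleftrightarrow>
       (\<forall>x\<in>S. f differentiable (at x)) \<and>
       (\<forall>v. Ck_on k (\<lambda>x. frechet_derivative f (at x) v) S)"

definition smooth_on :: "'e::euclidean_space set \<Rightarrow> ('e \<Rightarrow> 'f::euclidean_space) \<Rightarrow> bool"
  where "smooth_on S f \<longleftrightarrow> (\<forall>k. Ck_on k f S)"


section \<open>Smooth manifolds\<close>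

record ('a, 'e) chart =
  chart_dom :: "'a set"
  chart_map :: "'a \<Rightarrow> 'e"

definition chart_inv :: "('a, 'e) chart \<Rightarrow> 'e \<Rightarrow> 'a"
  where "chart_inv c = inv_into (chart_dom c) (chart_map c)"

text \<open>A manifold carries an arbitrary smooth atlas, standing for the maximal atlas that it
  generates. The dimension is \<open>DIM('e)\<close>.\<close>

record ('a, 'e) manifold =
  mtop :: "'a topology"
  atlas :: "('a, 'e) chart set"

definition is_chart :: "'a topology \<Rightarrow> ('a, 'e::euclidean_space) chart \<Rightarrow> bool"
  where "is_chart X c \<longleftrightarrow>
    openin X (chart_dom c) \<and>
    open (chart_map c ` chart_dom c) \<and>
    homeomorphic_map (subtopology X (chart_dom c)) (top_of_set (chart_map c ` chart_dom c))
      (chart_map c)"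

definition smooth_manifold :: "('a, 'e::euclidean_space, 'z) manifold_scheme \<Rightarrow> bool"
  where "smooth_manifold M \<longleftrightarrow>
    Hausdorff_space (mtop M) \<and> second_countable (mtop M) \<and>
    (\<forall>c\<in>atlas M. is_chart (mtop M) c) \<and>
    \<Union> (chart_dom ` atlas M) = topspace (mtop M) \<and>
    (\<forall>c\<in>atlas M. \<forall>d\<in>atlas M.
       smooth_on (chart_map c ` (chart_dom c \<inter> chart_dom d)) (chart_map d \<circ> chart_inv c))"

definition smooth_map ::
    "('a, 'e::euclidean_space, 'y) manifold_scheme \<Rightarrow>
     ('b, 'f::euclidean_space, 'z) manifold_scheme \<Rightarrow> ('a \<Rightarrow> 'b) \<Rightarrow> bool"
  where "smooth_map M N \<phi> \<longleftrightarrow>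
    continuous_map (mtop M) (mtop N) \<phi> \<and>
    (\<forall>c\<in>atlas M. \<forall>d\<in>atlas N.
       smooth_on (chart_map c ` (chart_dom c \<inter> \<phi> -` chart_dom d))
         (chart_map d \<circ> \<phi> \<circ> chart_inv c))"

definition smooth_fun ::
    "('a, 'e::euclidean_space, 'z) manifold_scheme \<Rightarrow> 'a set \<Rightarrow> ('a \<Rightarrow> real) \<Rightarrow> bool"
  where "smooth_fun M U f \<longleftrightarrow>
    (\<forall>c\<in>atlas M. smooth_on (chart_map c ` (chart_dom c \<inter> U)) (f \<circ> chart_inv c))"


section \<open>Tangent vectors, vector fields, sections along a map\<close>

text \<open>A chart \<open>chart_at M x\<close> around every point \<open>x\<close> is singled out, and the tangent space at \<open>x\<close> is
  \<open>'e\<close>: the vector \<open>v\<close> stands for the tangent vector at \<open>x\<close> whose coordinates in \<open>chart_at M x\<close> are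
  \<open>v\<close>. Its coordinates in another chart \<open>c\<close> around \<open>x\<close> are \<open>vec_in M c x v\<close>. Since \<open>chart_at M x\<close>
  may jump with \<open>x\<close>, the smoothness of fields is always expressed by means of \<open>vec_in\<close>.\<close>

definition chart_at :: "('a, 'e, 'z) manifold_scheme \<Rightarrow> 'a \<Rightarrow> ('a, 'e) chart"
  where "chart_at M x = (SOME c. c \<in> atlas M \<and> x \<in> chart_dom c)"

definition vec_in ::
    "('a, 'e::euclidean_space, 'z) manifold_scheme \<Rightarrow> ('a, 'e) chart \<Rightarrow> 'a \<Rightarrow> 'e \<Rightarrow> 'e"
  where "vec_in M c x v =
    frechet_derivative (chart_map c \<circ> chart_inv (chart_at M x)) (at (chart_map (chart_at M x) x)) v"

definition dir_deriv ::
    "('a, 'e::euclidean_space, 'z) manifold_scheme \<Rightarrow> ('a \<Rightarrow> real) \<Rightarrow> 'a \<Rightarrow> 'e \<Rightarrow> real"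
  where "dir_deriv M f x v =
    frechet_derivative (f \<circ> chart_inv (chart_at M x)) (at (chart_map (chart_at M x) x)) v"

text \<open>\<open>differential M N \<phi> x v\<close> is \<open>d\<phi>\<^sub>x(v)\<close>.\<close>

definition differential ::
    "('a, 'e::euclidean_space, 'y) manifold_scheme \<Rightarrow>
     ('b, 'f::euclidean_space, 'z) manifold_scheme \<Rightarrow> ('a \<Rightarrow> 'b) \<Rightarrow> 'a \<Rightarrow> 'e \<Rightarrow> 'f"
  where "differential M N \<phi> x v =
    frechet_derivative (chart_map (chart_at N (\<phi> x)) \<circ> \<phi> \<circ> chart_inv (chart_at M x))
      (at (chart_map (chart_at M x) x)) v"

definition vector_fields ::
    "('a, 'e::euclidean_space, 'z) manifold_scheme \<Rightarrow> 'a set \<Rightarrow> ('a \<Rightarrow> 'e) set"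
  where "vector_fields M U = {X. \<forall>c\<in>atlas M.
    smooth_on (chart_map c ` (chart_dom c \<inter> U)) ((\<lambda>x. vec_in M c x (X x)) \<circ> chart_inv c)}"

text \<open>Smooth sections over \<open>U\<close> of the pull-back bundle \<open>\<phi>\<^sup>-\<^sup>1TN\<close>.\<close>

definition sections_along ::
    "('a, 'e::euclidean_space, 'y) manifold_scheme \<Rightarrow>
     ('b, 'f::euclidean_space, 'z) manifold_scheme \<Rightarrow> ('a \<Rightarrow> 'b) \<Rightarrow> 'a set \<Rightarrow> ('a \<Rightarrow> 'f) set"
  where "sections_along M N \<phi> U = {V. \<forall>c\<in>atlas M. \<forall>d\<in>atlas N.
    smooth_on (chart_map c ` (chart_dom c \<inter> U \<inter> \<phi> -` chart_dom d))
      ((\<lambda>x. vec_in N d (\<phi> x) (V x)) \<circ> chart_inv c)}"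

text \<open>In coordinates, \<open>[X, Y] = DY(X) - DX(Y)\<close>. In its own preferred chart, a tangent vector is its
  coordinate vector.\<close>

definition lie_bracket ::
    "('a, 'e::euclidean_space, 'z) manifold_scheme \<Rightarrow> ('a \<Rightarrow> 'e) \<Rightarrow> ('a \<Rightarrow> 'e) \<Rightarrow> 'a \<Rightarrow> 'e"
  where "lie_bracket M X Y x =
    (let c = chart_at M x;
         coords = (\<lambda>Z. (\<lambda>y. vec_in M c y (Z y)) \<circ> chart_inv c)
     in frechet_derivative (coords Y) (at (chart_map c x)) (X x)
      - frechet_derivative (coords X) (at (chart_map c x)) (Y x))"

text \<open>The local field through \<open>v\<close> at \<open>x\<close> with constant coordinates in \<open>chart_at M x\<close>; it is smooth on
  the domain of that chart. It is used to evaluate tensors on single vectors.\<close>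

definition extend_vec ::
    "('a, 'e::euclidean_space, 'z) manifold_scheme \<Rightarrow> 'a \<Rightarrow> 'e \<Rightarrow> 'a \<Rightarrow> 'e"
  where "extend_vec M x v y =
    frechet_derivative (chart_map (chart_at M y) \<circ> chart_inv (chart_at M x))
      (at (chart_map (chart_at M x) y)) v"


section \<open>Pseudo-Riemannian metrics\<close>

record ('a, 'e) metric_manifold = "('a, 'e) manifold" +
  metric :: "'a \<Rightarrow> 'e \<Rightarrow> 'e \<Rightarrow> real"

definition form_index :: "('e::euclidean_space \<Rightarrow> 'e \<Rightarrow> real) \<Rightarrow> nat"
  where "form_index b =
    (GREATEST k. \<exists>S. subspace S \<and> dim S = k \<and> (\<forall>v\<in>S. v \<noteq> 0 \<longrightarrow> b v v < 0))"

definition pseudo_riemannian ::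
    "nat \<Rightarrow> ('a, 'e::euclidean_space, 'z) metric_manifold_scheme \<Rightarrow> bool"
  where "pseudo_riemannian p M \<longleftrightarrow>
    smooth_manifold M \<and>
    (\<forall>x\<in>topspace (mtop M).
       bilinear (metric M x) \<and>
       (\<forall>u v. metric M x u v = metric M x v u) \<and>
       (\<forall>u. (\<forall>v. metric M x u v = 0) \<longrightarrow> u = 0) \<and>
       form_index (metric M x) = p) \<and>
    (\<forall>U. openin (mtop M) U \<longrightarrow> (\<forall>X\<in>vector_fields M U. \<forall>Y\<in>vector_fields M U.
       smooth_fun M U (\<lambda>x. metric M x (X x) (Y x))))"

definition frame_sign :: "nat \<Rightarrow> nat \<Rightarrow> real"
  where "frame_sign p i = (if i \<le> p then - 1 else 1)"

text \<open>Frames \<open>e\<close> are indexed by \<open>1, \<dots>, m\<close>, where \<open>m = DIM('e)\<close>.\<close>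

definition orthonormal_frame ::
    "nat \<Rightarrow> ('a, 'e::euclidean_space, 'z) metric_manifold_scheme \<Rightarrow> 'a set \<Rightarrow>
     (nat \<Rightarrow> 'a \<Rightarrow> 'e) \<Rightarrow> bool"
  where "orthonormal_frame p M U e \<longleftrightarrow>
    openin (mtop M) U \<and>
    (\<forall>i\<in>{1..DIM('e)}. e i \<in> vector_fields M U) \<and>
    (\<forall>x\<in>U. \<forall>i\<in>{1..DIM('e)}. \<forall>j\<in>{1..DIM('e)}.
       metric M x (e i x) (e j x) = (if i = j then frame_sign p i else 0))"


section \<open>Connections\<close>

text \<open>A connection on a vector bundle over \<open>M\<close> whose smooth sections over an open set \<open>U\<close> are
  \<open>\<Gamma> U\<close>: for a local section \<open>V\<close>, a point \<open>x\<close> of its domain and a tangent vector \<open>v\<close> at \<open>x\<close>,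
  \<open>D V x v\<close> is the covariant derivative of \<open>V\<close> at \<open>x\<close> in the direction \<open>v\<close>. For a vector field \<open>X\<close>,
  the section \<open>D\<^sub>X V\<close> is \<open>\<lambda>x. D V x (X x)\<close>. The values of \<open>D\<close> on functions that are not smooth near
  \<open>x\<close> are irrelevant.\<close>

definition linear_connection ::
    "('a, 'e::euclidean_space, 'z) manifold_scheme \<Rightarrow>
     ('a set \<Rightarrow> ('a \<Rightarrow> 'f::euclidean_space) set) \<Rightarrow>
     (('a \<Rightarrow> 'f) \<Rightarrow> 'a \<Rightarrow> 'e \<Rightarrow> 'f) \<Rightarrow> bool"
  where "linear_connection M \<Gamma> D \<longleftrightarrow>
    (\<forall>U. openin (mtop M) U \<longrightarrow> (\<forall>V\<in>\<Gamma> U.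
       (\<forall>x\<in>U. linear (D V x)) \<and>
       (\<forall>X\<in>vector_fields M U. (\<lambda>x. D V x (X x)) \<in> \<Gamma> U) \<and>
       (\<forall>W\<in>\<Gamma> U. \<forall>x\<in>U. \<forall>v. D (\<lambda>y. V y + W y) x v = D V x v + D W x v) \<and>
       (\<forall>f. smooth_fun M U f \<longrightarrow> (\<forall>x\<in>U. \<forall>v.
          D (\<lambda>y. f y *\<^sub>R V y) x v = dir_deriv M f x v *\<^sub>R V x + f x *\<^sub>R D V x v)) \<and>
       (\<forall>W. (\<forall>y\<in>U. W y = V y) \<longrightarrow> (\<forall>x\<in>U. D W x = D V x))))"

definition levi_civita ::
    "('a, 'e::euclidean_space, 'z) metric_manifold_scheme \<Rightarrow>
     (('a \<Rightarrow> 'e) \<Rightarrow> 'a \<Rightarrow> 'e \<Rightarrow> 'e) \<Rightarrow> bool"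
  where "levi_civita M D \<longleftrightarrow>
    linear_connection M (vector_fields M) D \<and>
    (\<forall>U. openin (mtop M) U \<longrightarrow> (\<forall>X\<in>vector_fields M U. \<forall>Y\<in>vector_fields M U. \<forall>x\<in>U.
       D Y x (X x) - D X x (Y x) = lie_bracket M X Y x \<and>
       (\<forall>v. dir_deriv M (\<lambda>y. metric M y (X y) (Y y)) x v =
             metric M x (D X x v) (Y x) + metric M x (X x) (D Y x v))))"

text \<open>The connection \<open>Db\<close> on \<open>\<phi>\<^sup>-\<^sup>1TN\<close> induced by the connection \<open>DN\<close> on \<open>TN\<close>; it is determined by
  its values on the sections \<open>W \<circ> \<phi>\<close>, because these generate all sections locally.\<close>

definition pullback_connection ::
    "('a, 'e::euclidean_space, 'y) manifold_scheme \<Rightarrow>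
     ('b, 'f::euclidean_space, 'z) manifold_scheme \<Rightarrow> ('a \<Rightarrow> 'b) \<Rightarrow>
     (('b \<Rightarrow> 'f) \<Rightarrow> 'b \<Rightarrow> 'f \<Rightarrow> 'f) \<Rightarrow> (('a \<Rightarrow> 'f) \<Rightarrow> 'a \<Rightarrow> 'e \<Rightarrow> 'f) \<Rightarrow> bool"
  where "pullback_connection M N \<phi> DN Db \<longleftrightarrow>
    linear_connection M (sections_along M N \<phi>) Db \<and>
    (\<forall>U. openin (mtop N) U \<longrightarrow> (\<forall>W\<in>vector_fields N U.
       \<forall>x\<in>topspace (mtop M). \<phi> x \<in> U \<longrightarrow>
         (\<forall>v. Db (\<lambda>y. W (\<phi> y)) x v = DN W (\<phi> x) (differential M N \<phi> x v))))"


section \<open>Curvature\<close>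

definition curv ::
    "('a, 'e::euclidean_space, 'z) manifold_scheme \<Rightarrow> (('a \<Rightarrow> 'e) \<Rightarrow> 'a \<Rightarrow> 'e \<Rightarrow> 'e) \<Rightarrow>
     ('a \<Rightarrow> 'e) \<Rightarrow> ('a \<Rightarrow> 'e) \<Rightarrow> ('a \<Rightarrow> 'e) \<Rightarrow> 'a \<Rightarrow> 'e"
  where "curv M D X Y Z x =
    D (\<lambda>y. D Z y (Y y)) x (X x) - D (\<lambda>y. D Z y (X y)) x (Y x) - D Z x (lie_bracket M X Y x)"

text \<open>\<open>nabla_curv M D X Y Z W = (\<nabla>\<^sub>X R)(Y, Z)W\<close>.\<close>

definition nabla_curv ::
    "('a, 'e::euclidean_space, 'z) manifold_scheme \<Rightarrow> (('a \<Rightarrow> 'e) \<Rightarrow> 'a \<Rightarrow> 'e \<Rightarrow> 'e) \<Rightarrow>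
     ('a \<Rightarrow> 'e) \<Rightarrow> ('a \<Rightarrow> 'e) \<Rightarrow> ('a \<Rightarrow> 'e) \<Rightarrow> ('a \<Rightarrow> 'e) \<Rightarrow> 'a \<Rightarrow> 'e"
  where "nabla_curv M D X Y Z W x =
    D (curv M D Y Z W) x (X x)
    - curv M D (\<lambda>y. D Y y (X y)) Z W x
    - curv M D Y (\<lambda>y. D Z y (X y)) W x
    - curv M D Y Z (\<lambda>y. D W y (X y)) x"

text \<open>The same tensors at a point, on single tangent vectors, as needed for vectors of \<open>T\<^sub>\<phi>\<^sub>(\<^sub>x\<^sub>)N\<close>
  that do not come from vector fields on \<open>N\<close>.\<close>

definition curv_at ::
    "('a, 'e::euclidean_space, 'z) manifold_scheme \<Rightarrow> (('a \<Rightarrow> 'e) \<Rightarrow> 'a \<Rightarrow> 'e \<Rightarrow> 'e) \<Rightarrow>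
     'a \<Rightarrow> 'e \<Rightarrow> 'e \<Rightarrow> 'e \<Rightarrow> 'e"
  where "curv_at M D x u v w =
    curv M D (extend_vec M x u) (extend_vec M x v) (extend_vec M x w) x"

definition nabla_curv_at ::
    "('a, 'e::euclidean_space, 'z) manifold_scheme \<Rightarrow> (('a \<Rightarrow> 'e) \<Rightarrow> 'a \<Rightarrow> 'e \<Rightarrow> 'e) \<Rightarrow>
     'a \<Rightarrow> 'e \<Rightarrow> 'e \<Rightarrow> 'e \<Rightarrow> 'e \<Rightarrow> 'e"
  where "nabla_curv_at M D x t u v w =
    nabla_curv M D (extend_vec M x t) (extend_vec M x u) (extend_vec M x v) (extend_vec M x w) x"


section \<open>Covariant derivatives of the differential\<close>

text \<open>Below, \<open>D\<close> is the connection on \<open>TM\<close> and \<open>Db\<close> the connection on \<open>\<phi>\<^sup>-\<^sup>1TN\<close>.\<close>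

definition nabla_d ::
    "('a, 'e::euclidean_space, 'y) manifold_scheme \<Rightarrow>
     ('b, 'f::euclidean_space, 'z) manifold_scheme \<Rightarrow> ('a \<Rightarrow> 'b) \<Rightarrow>
     (('a \<Rightarrow> 'e) \<Rightarrow> 'a \<Rightarrow> 'e \<Rightarrow> 'e) \<Rightarrow> (('a \<Rightarrow> 'f) \<Rightarrow> 'a \<Rightarrow> 'e \<Rightarrow> 'f) \<Rightarrow>
     ('a \<Rightarrow> 'e) \<Rightarrow> ('a \<Rightarrow> 'e) \<Rightarrow> 'a \<Rightarrow> 'f"
  where "nabla_d M N \<phi> D Db X Y x =
    Db (\<lambda>y. differential M N \<phi> y (Y y)) x (X x) - differential M N \<phi> x (D Y x (X x))"

definition nabla2_d ::
    "('a, 'e::euclidean_space, 'y) manifold_scheme \<Rightarrow>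
     ('b, 'f::euclidean_space, 'z) manifold_scheme \<Rightarrow> ('a \<Rightarrow> 'b) \<Rightarrow>
     (('a \<Rightarrow> 'e) \<Rightarrow> 'a \<Rightarrow> 'e \<Rightarrow> 'e) \<Rightarrow> (('a \<Rightarrow> 'f) \<Rightarrow> 'a \<Rightarrow> 'e \<Rightarrow> 'f) \<Rightarrow>
     ('a \<Rightarrow> 'e) \<Rightarrow> ('a \<Rightarrow> 'e) \<Rightarrow> ('a \<Rightarrow> 'e) \<Rightarrow> 'a \<Rightarrow> 'f"
  where "nabla2_d M N \<phi> D Db X Y Z x =
    Db (nabla_d M N \<phi> D Db Y Z) x (X x)
    - nabla_d M N \<phi> D Db (\<lambda>y. D Y y (X y)) Z x
    - nabla_d M N \<phi> D Db Y (\<lambda>y. D Z y (X y)) x"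

definition nabla3_d ::
    "('a, 'e::euclidean_space, 'y) manifold_scheme \<Rightarrow>
     ('b, 'f::euclidean_space, 'z) manifold_scheme \<Rightarrow> ('a \<Rightarrow> 'b) \<Rightarrow>
     (('a \<Rightarrow> 'e) \<Rightarrow> 'a \<Rightarrow> 'e \<Rightarrow> 'e) \<Rightarrow> (('a \<Rightarrow> 'f) \<Rightarrow> 'a \<Rightarrow> 'e \<Rightarrow> 'f) \<Rightarrow>
     ('a \<Rightarrow> 'e) \<Rightarrow> ('a \<Rightarrow> 'e) \<Rightarrow> ('a \<Rightarrow> 'e) \<Rightarrow> ('a \<Rightarrow> 'e) \<Rightarrow> 'a \<Rightarrow> 'f"
  where "nabla3_d M N \<phi> D Db X Y Z W x =
    Db (nabla2_d M N \<phi> D Db Y Z W) x (X x)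
    - nabla2_d M N \<phi> D Db (\<lambda>y. D Y y (X y)) Z W x
    - nabla2_d M N \<phi> D Db Y (\<lambda>y. D Z y (X y)) W x
    - nabla2_d M N \<phi> D Db Y Z (\<lambda>y. D W y (X y)) x"


section \<open>Chern--Federer maps\<close>

definition W1 ::
    "nat \<Rightarrow> ('a, 'e::euclidean_space, 'y) manifold_scheme \<Rightarrow>
     ('b, 'f::euclidean_space, 'z) manifold_scheme \<Rightarrow> ('a \<Rightarrow> 'b) \<Rightarrow>
     (('a \<Rightarrow> 'e) \<Rightarrow> 'a \<Rightarrow> 'e \<Rightarrow> 'e) \<Rightarrow> (('b \<Rightarrow> 'f) \<Rightarrow> 'b \<Rightarrow> 'f \<Rightarrow> 'f) \<Rightarrow>
     (('a \<Rightarrow> 'f) \<Rightarrow> 'a \<Rightarrow> 'e \<Rightarrow> 'f) \<Rightarrow> (nat \<Rightarrow> 'a \<Rightarrow> 'e) \<Rightarrow> 'a \<Rightarrow> 'f"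
  where "W1 p M N \<phi> DM DN Db e x =
    (\<Sum>i=1..DIM('e). \<Sum>j=1..DIM('e). (frame_sign p i * frame_sign p j) *\<^sub>R
      (nabla3_d M N \<phi> DM Db (e i) (e j) (e i) (e j) x
       + curv_at N DN (\<phi> x) (nabla_d M N \<phi> DM Db (e i) (e j) x)
           (differential M N \<phi> x (e i x)) (differential M N \<phi> x (e j x))))"

definition W2 ::
    "nat \<Rightarrow> ('a, 'e::euclidean_space, 'y) manifold_scheme \<Rightarrow>
     ('b, 'f::euclidean_space, 'z) manifold_scheme \<Rightarrow> ('a \<Rightarrow> 'b) \<Rightarrow>
     (('a \<Rightarrow> 'e) \<Rightarrow> 'a \<Rightarrow> 'e \<Rightarrow> 'e) \<Rightarrow> (('b \<Rightarrow> 'f) \<Rightarrow> 'b \<Rightarrow> 'f \<Rightarrow> 'f) \<Rightarrow>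
     (('a \<Rightarrow> 'f) \<Rightarrow> 'a \<Rightarrow> 'e \<Rightarrow> 'f) \<Rightarrow> (nat \<Rightarrow> 'a \<Rightarrow> 'e) \<Rightarrow> 'a \<Rightarrow> 'f"
  where "W2 p M N \<phi> DM DN Db e x =
    (\<Sum>i=1..DIM('e). \<Sum>j=1..DIM('e). (frame_sign p i * frame_sign p j) *\<^sub>R
      (nabla3_d M N \<phi> DM Db (e i) (e i) (e j) (e j) x
       + curv_at N DN (\<phi> x) (nabla_d M N \<phi> DM Db (e i) (e i) x)
           (differential M N \<phi> x (e j x)) (differential M N \<phi> x (e j x))))"

text \<open>Being traces, \<open>W1\<close> and \<open>W2\<close> do not depend on the local frame; the equation is imposed for all
  frames, hence at all points.\<close>

definition chern_federer_map ::
    "nat \<Rightarrow> ('a, 'e::euclidean_space, 'y) metric_manifold_scheme \<Rightarrow>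
     ('b, 'f::euclidean_space, 'z) metric_manifold_scheme \<Rightarrow> ('a \<Rightarrow> 'b) \<Rightarrow>
     (('a \<Rightarrow> 'e) \<Rightarrow> 'a \<Rightarrow> 'e \<Rightarrow> 'e) \<Rightarrow> (('b \<Rightarrow> 'f) \<Rightarrow> 'b \<Rightarrow> 'f \<Rightarrow> 'f) \<Rightarrow>
     (('a \<Rightarrow> 'f) \<Rightarrow> 'a \<Rightarrow> 'e \<Rightarrow> 'f) \<Rightarrow> bool"
  where "chern_federer_map p M N \<phi> DM DN Db \<longleftrightarrow>
    smooth_map M N \<phi> \<and>
    (\<forall>U e. orthonormal_frame p M U e \<longrightarrow>
       (\<forall>x\<in>U. W2 p M N \<phi> DM DN Db e x - W1 p M N \<phi> DM DN Db e x = 0))"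

end

theory Submission
  imports Defs
begin

text \<open>
  The identity \<open>W\<^sub>2 - W\<^sub>1 = \<dots>\<close> holds pointwise, for any family of fields \<open>e\<^sub>i\<close> and signs \<open>\<epsilon>\<^sub>i\<close>.
  The curvature of the pull-back connection is \<open>R\<^sup>N(d\<phi> X, d\<phi> Y)\<close>, so commuting the first two
  derivatives in \<open>\<nabla>\<^sup>2d\<phi>\<close> gives the Ricci identity
  \<open>(\<nabla>\<^sup>2d\<phi>)(Y,Z,W) - (\<nabla>\<^sup>2d\<phi>)(Z,Y,W) = R\<^sup>N(d\<phi> Y, d\<phi> Z) d\<phi> W - d\<phi>(R\<^sup>M(Y,Z)W)\<close>.
  Its covariant derivative expresses \<open>(\<nabla>\<^sup>3d\<phi>)(e\<^sub>i,e\<^sub>i,e\<^sub>j,e\<^sub>j) - (\<nabla>\<^sup>3d\<phi>)(e\<^sub>i,e\<^sub>j,e\<^sub>i,e\<^sub>j)\<close> by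
  curvature terms. The only one not in the claim, \<open>R\<^sup>N(d\<phi> e\<^sub>i, d\<phi> e\<^sub>j)(\<nabla>d\<phi>)(e\<^sub>i,e\<^sub>j)\<close>, is antisymmetric
  in \<open>i, j\<close> and drops out of the sum.

  Identities between curvature expressions are reduced to fields that are constant in a chart of
  \<open>N\<close>, because both sides are linear over the smooth functions. Facts about \<open>N\<close> alone, such as the
  tensoriality of \<open>R\<^sup>N\<close>, are the case \<open>\<phi> = id\<close> of facts about the pull-back connection.
\<close>

section \<open>Calculus of smooth functions\<close>

text \<open>Two obstacles shape the proof. A tangent vector at \<open>x\<close> is its coordinate
  vector in \<open>chart_at M x\<close>, which may jump with \<open>x\<close>, so a field cannot be
  differentiated as a plain function; computations pass to one fixed chart by \<open>vec_in\<close>.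
  Moreover \<open>d\<phi> y (X y)\<close> need not come from a vector field on \<open>N\<close>,
  whereas \<open>curv\<close> and \<open>nabla_curv\<close> act on fields. Both are met by the
  coordinate fields \<open>extend_vec N (\<phi> x) b\<close>: composed with \<phi> they frame the
  pull-back bundle near \<open>x\<close>, and on them the pull-back connection is given by
  \<open>DN\<close>. Torsion freeness enters twice. It makes the derivative of
  \<open>d\<phi> Y\<close> along \<open>X\<close> minus that of \<open>d\<phi> X\<close> along
  \<open>Y\<close> equal to \<phi>-image of the bracket, which turns the curvature of the pull-back
  connection into that of \<open>N\<close>; and it makes \<nabla>d\<phi> symmetric, which is what
  the antisymmetry of the extra term rests on.\<close>

lemma Ck_on_cong:
  assumes "open S" "\<And>x. x \<in> S \<Longrightarrow> f x = g x" "Ck_on k f S"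
  shows "Ck_on k g S"
  using assms(2,3)
proof (induction k arbitrary: f g)
  case 0
  then show ?case by (metis Ck_on.simps(1) continuous_on_cong)
next
  case (Suc k)
  have d: "f differentiable (at x)" if "x \<in> S" for x
    using Suc.prems that by auto
  have fr: "frechet_derivative f (at x) v = frechet_derivative g (at x) v" if "x \<in> S" for x v
    using frechet_derivative_transform_within_open[OF d[OF that] assms(1) that Suc.prems(1)] by simp
  have "g differentiable (at x)" if "x \<in> S" for x
    using d[OF that] assms(1) Suc.prems(1) that
    by (metis differentiable_def has_derivative_transform_within_open)
  moreover have "Ck_on k (\<lambda>x. frechet_derivative g (at x) v) S" for v
    using Suc.prems(2) by (intro Suc.IH[OF fr[of _ v]]) simp_all
  ultimately show ?case
    by simp
qed

lemma Ck_on_const: "Ck_on k (\<lambda>x. c) S"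
  by (induction k arbitrary: c) auto

text \<open>Derivatives at a point are unique and \<open>S\<close> is open, so
  \<open>Ck_on_cong\<close> exchanges \<open>f'\<close> for \<open>frechet_derivative f\<close>. The
  inductions below can thus take the derivative in the form that the differentiation rules
  deliver.\<close>

lemma Ck_on_SucI:
  assumes "open S" "\<And>x. x \<in> S \<Longrightarrow> (f has_derivative f' x) (at x)"
    and "\<And>v. Ck_on k (\<lambda>x. f' x v) S"
  shows "Ck_on (Suc k) f S"
proof -
  have "f' x v = frechet_derivative f (at x) v" if "x \<in> S" for x v
    using frechet_derivative_at[OF assms(2)[OF that]] by simp
  then have "Ck_on k (\<lambda>x. frechet_derivative f (at x) v) S" for v
    by (rule Ck_on_cong[OF assms(1) _ assms(3)])
  moreover have "\<forall>x\<in>S. f differentiable (at x)"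
    using assms(2) unfolding differentiable_def by blast
  ultimately show ?thesis
    by simp
qed

lemma Ck_on_SucD:
  assumes "Ck_on (Suc k) f S"
  shows "x \<in> S \<Longrightarrow> (f has_derivative frechet_derivative f (at x)) (at x)"
    and "Ck_on k (\<lambda>x. frechet_derivative f (at x) v) S"
  using assms frechet_derivative_works by auto

lemma Ck_on_subset:
  assumes "T \<subseteq> S" "Ck_on k f S"
  shows "Ck_on k f T"
  using assms(2)
proof (induction k arbitrary: f)
  case 0
  then show ?case
    using assms(1) by (simp add: continuous_on_subset)
next
  case (Suc k)
  show ?case
    using Suc.prems assms(1) Suc.IH[OF Ck_on_SucD(2)[OF Suc.prems]] by auto
qed

lemma Ck_on_lower: "Ck_on (Suc k) f S \<Longrightarrow> Ck_on k f S"
proof (induction k arbitrary: f)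
  case 0
  then show ?case
    by (simp add: continuous_at_imp_continuous_on differentiable_imp_continuous_within)
next
  case (Suc k)
  show ?case
    using Suc.prems Suc.IH[OF Ck_on_SucD(2)[OF Suc.prems]] by simp
qed

lemma Ck_on_linear_comp:
  assumes "open S" "bounded_linear L" "Ck_on k f S"
  shows "Ck_on k (\<lambda>x. L (f x)) S"
  using assms(3)
proof (induction k arbitrary: f)
  case 0
  then show ?case
    by (auto intro: bounded_linear.continuous_on[OF assms(2)])
next
  case (Suc k)
  note f = Ck_on_SucD[OF Suc.prems]
  show ?case
    by (rule Ck_on_SucI[OF assms(1) bounded_linear.has_derivative[OF assms(2) f(1)] Suc.IH[OF f(2)]])
qed

lemma Ck_on_add:
  assumes "open S" "Ck_on k f S" "Ck_on k g S"
  shows "Ck_on k (\<lambda>x. f x + g x) S"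
  using assms(2,3)
proof (induction k arbitrary: f g)
  case 0
  then show ?case by (auto intro: continuous_on_add)
next
  case (Suc k)
  note f = Ck_on_SucD[OF Suc.prems(1)] and g = Ck_on_SucD[OF Suc.prems(2)]
  show ?case
    by (rule Ck_on_SucI[OF assms(1) has_derivative_add[OF f(1) g(1)] Suc.IH[OF f(2) g(2)]])
qed

text \<open>The product rule returns \<open>f\<close> and \<open>g\<close> undifferentiated next to
  their derivatives, so the induction hypothesis needs them one order lower, which is
  \<open>Ck_on_lower\<close>.\<close>

lemma Ck_on_scaleR:
  fixes f :: "'e::euclidean_space \<Rightarrow> real"
  assumes "open S" "Ck_on k f S" "Ck_on k g S"
  shows "Ck_on k (\<lambda>x. f x *\<^sub>R g x) S"
  using assms(2,3)
proof (induction k arbitrary: f g)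
  case 0
  then show ?case by (auto intro: continuous_on_scaleR)
next
  case (Suc k)
  note f = Ck_on_SucD[OF Suc.prems(1)] and g = Ck_on_SucD[OF Suc.prems(2)]
  show ?case
    by (rule Ck_on_SucI[OF assms(1) has_derivative_scaleR[OF f(1) g(1)]
          Ck_on_add[OF assms(1) Suc.IH[OF Ck_on_lower[OF Suc.prems(1)] g(2)]
            Suc.IH[OF f(2) Ck_on_lower[OF Suc.prems(2)]]]])
qed

lemma Ck_on_sum:
  assumes "open S" "\<And>b. b \<in> B \<Longrightarrow> Ck_on k (f b) S"
  shows "Ck_on k (\<lambda>x. \<Sum>b\<in>B. f b x) S"
  using assms(2)
  by (induction B rule: infinite_finite_induct) (simp_all add: Ck_on_const Ck_on_add[OF assms(1)])

lemma linear_basis_expansion: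
  assumes "linear (L :: 'e::euclidean_space \<Rightarrow> 'f::real_vector)"
  shows "L v = (\<Sum>b\<in>Basis. (v \<bullet> b) *\<^sub>R L b)"
proof -
  have "L v = L (\<Sum>b\<in>Basis. (v \<bullet> b) *\<^sub>R b)"
    by (simp add: euclidean_representation)
  also have "\<dots> = (\<Sum>b\<in>Basis. (v \<bullet> b) *\<^sub>R L b)"
    by (simp add: linear_sum[OF assms] linear_scale[OF assms])
  finally show ?thesis .
qed

lemma linear_from_combination:
  fixes f :: "'u::real_vector \<Rightarrow> 'v::real_vector"
  assumes "\<And>r u v. f (r *\<^sub>R u + v) = r *\<^sub>R f u + f v"
  shows "linear f"
proof (rule linearI)
  have "f 0 = 0"
    using assms[of 1 0 0] by simp
  then show "f (r *\<^sub>R u) = r *\<^sub>R f u" for r u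
    using assms[of r u 0] by simp
  show "f (u + v) = f u + f v" for u v
    using assms[of 1 u v] by simp
qed

text \<open>In the chain rule the outer derivative is taken in a direction that moves with the
  point, while \<open>Ck_on\<close> controls fixed directions only. Expanding this direction in the
  basis leaves products of components of the derivative of \<open>f\<close> with partial derivatives
  of \<open>g\<close> composed with \<open>f\<close>; the latter are covered by the induction
  hypothesis because \<open>g\<close> is arbitrary in it.\<close>

lemma Ck_on_compose:
  assumes "open S" "open T" "f ` S \<subseteq> T" "Ck_on k f S" "Ck_on k g T"
  shows "Ck_on k (g \<circ> f) S"
  using assms(3-5)
proof (induction k arbitrary: g)
  case 0
  then show ?case
    by (auto intro!: continuous_on_compose2[of T g S f])
next
  case (Suc k)
  note f = Ck_on_SucD[OF Suc.prems(2)] and g = Ck_on_SucD[OF Suc.prems(3)]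
  have "(g \<circ> f has_derivative (\<lambda>v. \<Sum>b\<in>Basis. (frechet_derivative f (at x) v \<bullet> b) *\<^sub>R
          ((\<lambda>y. frechet_derivative g (at y) b) \<circ> f) x)) (at x)" if "x \<in> S" for x
  proof -
    have fx: "f x \<in> T"
      using Suc.prems(1) that by auto
    show ?thesis
      using diff_chain_at[OF f(1)[OF that] g(1)[OF fx]]
      by (simp add: o_def linear_basis_expansion[OF has_derivative_linear[OF g(1)[OF fx]], symmetric])
  qed
  moreover have "Ck_on k (\<lambda>x. \<Sum>b\<in>Basis. (frechet_derivative f (at x) v \<bullet> b) *\<^sub>R
          ((\<lambda>y. frechet_derivative g (at y) b) \<circ> f) x) S" for v
    by (intro Ck_on_sum Ck_on_scaleR assms(1)
        Ck_on_linear_comp[OF assms(1) bounded_linear_inner_left] f(2)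
        Suc.IH[OF Suc.prems(1) Ck_on_lower[OF Suc.prems(2)] g(2)])
  ultimately show ?case
    by (rule Ck_on_SucI[OF assms(1)])
qed

section \<open>Closure properties of smoothness of all orders\<close>

lemma smooth_on_cong:
  assumes "open S" "\<And>x. x \<in> S \<Longrightarrow> f x = g x" "smooth_on S f"
  shows "smooth_on S g"
  unfolding smooth_on_def
proof
  show "Ck_on k g S" for k
    by (rule Ck_on_cong[OF assms(1,2)]) (use assms(3) in \<open>simp_all add: smooth_on_def\<close>)
qed

lemma smooth_on_subset: "smooth_on S f \<Longrightarrow> T \<subseteq> S \<Longrightarrow> smooth_on T f"
  by (simp add: smooth_on_def Ck_on_subset)

lemma smooth_on_const: "smooth_on S (\<lambda>x. c)"
  by (simp add: smooth_on_def Ck_on_const)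

lemma smooth_on_linear_comp:
  "open S \<Longrightarrow> bounded_linear L \<Longrightarrow> smooth_on S f \<Longrightarrow> smooth_on S (\<lambda>x. L (f x))"
  by (simp add: smooth_on_def Ck_on_linear_comp)

lemma smooth_on_add:
  "open S \<Longrightarrow> smooth_on S f \<Longrightarrow> smooth_on S g \<Longrightarrow> smooth_on S (\<lambda>x. f x + g x)"
  by (simp add: smooth_on_def Ck_on_add)

lemma smooth_on_scaleR:
  fixes f :: "'e::euclidean_space \<Rightarrow> real"
  shows "open S \<Longrightarrow> smooth_on S f \<Longrightarrow> smooth_on S g \<Longrightarrow> smooth_on S (\<lambda>x. f x *\<^sub>R g x)"
  by (simp add: smooth_on_def Ck_on_scaleR)

lemma smooth_on_sum:
  "open S \<Longrightarrow> (\<And>b. b \<in> B \<Longrightarrow> smooth_on S (f b)) \<Longrightarrow> smooth_on S (\<lambda>x. \<Sum>b\<in>B. f b x)"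
  by (simp add: smooth_on_def Ck_on_sum)

lemma smooth_on_compose:
  "open S \<Longrightarrow> open T \<Longrightarrow> f ` S \<subseteq> T \<Longrightarrow> smooth_on S f \<Longrightarrow> smooth_on T g \<Longrightarrow> smooth_on S (g \<circ> f)"
  by (simp add: smooth_on_def Ck_on_compose)

lemma smooth_on_imp_differentiable:
  assumes "smooth_on S f" "x \<in> S"
  shows "f differentiable (at x)"
proof -
  have "Ck_on (Suc 0) f S"
    using assms(1) unfolding smooth_on_def by blast
  then show ?thesis
    using assms(2) by simp
qed

lemma smooth_on_partial:
  assumes "smooth_on S f"
  shows "smooth_on S (\<lambda>x. frechet_derivative f (at x) v)"
  unfolding smooth_on_def
proof
  show "Ck_on k (\<lambda>x. frechet_derivative f (at x) v) S" for k
    by (rule Ck_on_SucD(2)) (use assms in \<open>simp only: smooth_on_def\<close>)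
qed

text \<open>Needed for \<open>d\<phi> y (X y)\<close> and for the derivative of a function along a
  field, where the direction moves with the point; hence the basis expansion.\<close>

lemma smooth_on_derivative_apply:
  assumes "open S" "smooth_on S f" "smooth_on S w"
  shows "smooth_on S (\<lambda>x. frechet_derivative f (at x) (w x))"
proof (rule smooth_on_cong[OF assms(1)])
  show "smooth_on S (\<lambda>x. \<Sum>b\<in>Basis. (w x \<bullet> b) *\<^sub>R frechet_derivative f (at x) b)"
    by (intro smooth_on_sum[OF assms(1)] smooth_on_scaleR[OF assms(1)] smooth_on_partial[OF assms(2)]
        smooth_on_linear_comp[OF assms(1) bounded_linear_inner_left assms(3)])
qed (simp add: linear_basis_expansion[OF linear_frechet_derivative
       [OF smooth_on_imp_differentiable[OF assms(2)]], symmetric])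

text \<open>The mean value theorem is applied along \<open>u\<close> to the difference of
  \<open>f\<close> on two parallel lines shifted by \<open>h *\<^sub>R v\<close>, and then along
  \<open>v\<close> to the partial derivative of \<open>f\<close> in direction
  \<open>u\<close>.\<close>

lemma second_difference_mean_value:
  fixes f :: "'e::euclidean_space \<Rightarrow> real"
  assumes "0 < h"
    and S: "\<And>s t. 0 \<le> s \<Longrightarrow> s \<le> h \<Longrightarrow> 0 \<le> t \<Longrightarrow> t \<le> h \<Longrightarrow> x + s *\<^sub>R u + t *\<^sub>R v \<in> S"
    and f: "smooth_on S f"
  shows "\<exists>s t. 0 \<le> s \<and> s \<le> h \<and> 0 \<le> t \<and> t \<le> h \<and>
    f (x + h *\<^sub>R u + h *\<^sub>R v) - f (x + h *\<^sub>R u) - f (x + h *\<^sub>R v) + f x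
      = h * h * frechet_derivative (\<lambda>y. frechet_derivative f (at y) u) (at (x + s *\<^sub>R u + t *\<^sub>R v)) v"
proof -
  have line: "((\<lambda>s. g (a + s *\<^sub>R w)) has_field_derivative frechet_derivative g (at (a + s *\<^sub>R w)) w) (at s)"
    if "g differentiable (at (a + s *\<^sub>R w))" for g :: "'e \<Rightarrow> real" and a w s
  proof -
    have "(g has_derivative frechet_derivative g (at (a + s *\<^sub>R w))) (at (a + s *\<^sub>R w))"
      using that frechet_derivative_works by blast
    then have "((\<lambda>s. g (a + s *\<^sub>R w)) has_derivative
        (\<lambda>k. frechet_derivative g (at (a + s *\<^sub>R w)) (k *\<^sub>R w))) (at s)"
      by (rule has_derivative_compose[rotated]) (auto intro!: derivative_eq_intros)
    then show ?thesis
      using linear_frechet_derivative[OF that]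
      by (simp add: has_field_derivative_def linear_scale mult_commute_abs)
  qed
  let ?Du = "\<lambda>y. frechet_derivative f (at y) u"
  have "\<exists>s>0. s < h \<and>
     (f ((x + h *\<^sub>R v) + h *\<^sub>R u) - f (x + h *\<^sub>R u)) - (f ((x + h *\<^sub>R v) + 0 *\<^sub>R u) - f (x + 0 *\<^sub>R u))
       = (h - 0) * (?Du ((x + h *\<^sub>R v) + s *\<^sub>R u) - ?Du (x + s *\<^sub>R u))"
  proof (rule MVT2[OF \<open>0 < h\<close>])
    fix s assume "0 \<le> s" "s \<le> h"
    then have "(x + h *\<^sub>R v) + s *\<^sub>R u \<in> S" "x + s *\<^sub>R u \<in> S"
      using S[of s h] S[of s 0] \<open>0 < h\<close> by (simp_all add: ac_simps)
    then show "((\<lambda>s. f ((x + h *\<^sub>R v) + s *\<^sub>R u) - f (x + s *\<^sub>R u)) has_field_derivative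
        (?Du ((x + h *\<^sub>R v) + s *\<^sub>R u) - ?Du (x + s *\<^sub>R u))) (at s)"
      by (intro DERIV_diff line smooth_on_imp_differentiable[OF f])
  qed
  then obtain s where s0: "0 < s" "s < h" and
    eq0: "(f ((x + h *\<^sub>R v) + h *\<^sub>R u) - f (x + h *\<^sub>R u)) - (f ((x + h *\<^sub>R v) + 0 *\<^sub>R u) - f (x + 0 *\<^sub>R u))
       = (h - 0) * (?Du ((x + h *\<^sub>R v) + s *\<^sub>R u) - ?Du (x + s *\<^sub>R u))"
    by blast
  have comm: "x + h *\<^sub>R v + r *\<^sub>R u = x + r *\<^sub>R u + h *\<^sub>R v" for r
    by simp
  have eq: "f (x + h *\<^sub>R u + h *\<^sub>R v) - f (x + h *\<^sub>R u) - f (x + h *\<^sub>R v) + f x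
       = h * (?Du ((x + s *\<^sub>R u) + h *\<^sub>R v) - ?Du ((x + s *\<^sub>R u) + 0 *\<^sub>R v))"
    using eq0 unfolding comm by simp
  have s: "0 \<le> s" "s \<le> h"
    using s0 by simp_all
  have "\<exists>t>0. t < h \<and> ?Du ((x + s *\<^sub>R u) + h *\<^sub>R v) - ?Du ((x + s *\<^sub>R u) + 0 *\<^sub>R v)
       = (h - 0) * frechet_derivative ?Du (at ((x + s *\<^sub>R u) + t *\<^sub>R v)) v"
    using s S
    by (intro MVT2[OF \<open>0 < h\<close>] line smooth_on_imp_differentiable[OF smooth_on_partial[OF f]]) auto
  then obtain t where t: "0 \<le> t" "t \<le> h"
    "?Du ((x + s *\<^sub>R u) + h *\<^sub>R v) - ?Du ((x + s *\<^sub>R u) + 0 *\<^sub>R v)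
       = h * frechet_derivative ?Du (at ((x + s *\<^sub>R u) + t *\<^sub>R v)) v"
    using less_imp_le by (metis diff_zero)
  show ?thesis
    using s t eq by auto
qed

text \<open>The second difference over a small parallelogram is symmetric in \<open>u\<close> and
  \<open>v\<close>, so some value of one mixed derivative near \<open>x\<close> equals some value of
  the other. If they differed at \<open>x\<close>, continuity would keep each within half of the gap
  of its value at \<open>x\<close>, and the two could not meet.\<close>

lemma second_derivative_symmetric:
  fixes f :: "'e::euclidean_space \<Rightarrow> real"
  assumes "open S" "x \<in> S" and f: "smooth_on S f"
  shows "frechet_derivative (\<lambda>y. frechet_derivative f (at y) u) (at x) v
       = frechet_derivative (\<lambda>y. frechet_derivative f (at y) v) (at x) u"
proof (rule ccontr)
  define P where "P u v y = frechet_derivative (\<lambda>y. frechet_derivative f (at y) u) (at y) v" for u v y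
  assume "\<not> ?thesis"
  then have e: "0 < \<bar>P u v x - P v u x\<bar> / 2"
    by (simp add: P_def)
  have cont: "isCont (P u v) x" for u v
    unfolding P_def
    using smooth_on_partial[OF smooth_on_partial[OF f]] assms(2)
    by (intro differentiable_imp_continuous_within smooth_on_imp_differentiable) auto
  obtain r where r: "r > 0" "ball x r \<subseteq> S"
    using assms(1,2) open_contains_ball by blast
  obtain d1 where d1: "d1 > 0" "\<And>y. dist y x < d1 \<Longrightarrow> dist (P u v y) (P u v x) < \<bar>P u v x - P v u x\<bar> / 2"
    using cont[of u v, unfolded continuous_at_eps_delta, rule_format, OF e] by (auto simp: dist_real_def)
  obtain d2 where d2: "d2 > 0" "\<And>y. dist y x < d2 \<Longrightarrow> dist (P v u y) (P v u x) < \<bar>P u v x - P v u x\<bar> / 2"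
    using cont[of v u, unfolded continuous_at_eps_delta, rule_format, OF e] by (auto simp: dist_real_def)
  define d where "d = min r (min d1 d2)"
  \<comment> \<open>Chosen so that the whole parallelogram stays within \<open>d\<close> of
    \<open>x\<close>; the summand 1 keeps the denominator positive when \<open>u\<close> and
    \<open>v\<close> vanish and makes the final estimate strict.\<close>
  define h where "h = d / (norm u + norm v + 1)"
  have d: "d > 0"
    using r d1 d2 by (simp add: d_def)
  then have h: "h > 0"
    by (simp add: h_def add_nonneg_pos)
  have near: "dist (x + s *\<^sub>R a + t *\<^sub>R b) x < d"
    if "0 \<le> s" "s \<le> h" "0 \<le> t" "t \<le> h" "norm a + norm b = norm u + norm v" for s t a b
  proof -
    have "dist (x + s *\<^sub>R a + t *\<^sub>R b) x \<le> s * norm a + t * norm b"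
      using norm_triangle_ineq[of "s *\<^sub>R a" "t *\<^sub>R b"] that by (simp add: dist_norm)
    also have "\<dots> \<le> h * norm a + h * norm b"
      using that by (intro add_mono mult_right_mono) auto
    also have "\<dots> = h * (norm u + norm v)"
      using that(5) by (metis distrib_left)
    also have "\<dots> < h * (norm u + norm v + 1)"
      using h by simp
    also have "\<dots> = d"
      by (simp add: h_def add_nonneg_pos less_imp_neq[THEN not_sym])
    finally show ?thesis .
  qed
  have "x + s *\<^sub>R a + t *\<^sub>R b \<in> S"
    if "0 \<le> s" "s \<le> h" "0 \<le> t" "t \<le> h" "norm a + norm b = norm u + norm v" for s t a b
    using near[OF that] r(2) by (auto simp: d_def dist_commute subset_iff)
  then obtain s t s' t' where st: "0 \<le> s" "s \<le> h" "0 \<le> t" "t \<le> h" "0 \<le> s'" "s' \<le> h" "0 \<le> t'" "t' \<le> h"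
    and P: "f (x + h *\<^sub>R u + h *\<^sub>R v) - f (x + h *\<^sub>R u) - f (x + h *\<^sub>R v) + f x
      = h * h * P u v (x + s *\<^sub>R u + t *\<^sub>R v)"
    and Q: "f (x + h *\<^sub>R v + h *\<^sub>R u) - f (x + h *\<^sub>R v) - f (x + h *\<^sub>R u) + f x
      = h * h * P v u (x + s' *\<^sub>R v + t' *\<^sub>R u)"
    using second_difference_mean_value[OF h _ f, of x u v] second_difference_mean_value[OF h _ f, of x v u]
    unfolding P_def by auto
  have comm: "x + h *\<^sub>R u + h *\<^sub>R v = x + h *\<^sub>R v + h *\<^sub>R u"
    by simp
  have "h * h * P u v (x + s *\<^sub>R u + t *\<^sub>R v) = h * h * P v u (x + s' *\<^sub>R v + t' *\<^sub>R u)"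
    unfolding P[symmetric] Q[symmetric] comm by simp
  then have "P u v (x + s *\<^sub>R u + t *\<^sub>R v) = P v u (x + s' *\<^sub>R v + t' *\<^sub>R u)"
    using h by simp
  moreover have "dist (P u v (x + s *\<^sub>R u + t *\<^sub>R v)) (P u v x) < \<bar>P u v x - P v u x\<bar> / 2"
    using near[of s t u v] st by (intro d1) (auto simp: d_def)
  moreover have "dist (P v u (x + s' *\<^sub>R v + t' *\<^sub>R u)) (P v u x) < \<bar>P u v x - P v u x\<bar> / 2"
    using near[of s' t' v u] st by (intro d2) (auto simp: d_def)
  ultimately show False
    by (simp add: dist_real_def abs_if split: if_splits)
qed

section \<open>Charts and coordinate representations\<close>

lemma atlas_is_chart: "smooth_manifold M \<Longrightarrow> c \<in> atlas M \<Longrightarrow> is_chart (mtop M) c"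
  by (simp add: smooth_manifold_def)

lemma chart_dom_open: "smooth_manifold M \<Longrightarrow> c \<in> atlas M \<Longrightarrow> openin (mtop M) (chart_dom c)"
  using atlas_is_chart unfolding is_chart_def by blast

lemma chart_inv_map [simp]:
  assumes "smooth_manifold M" "c \<in> atlas M" "y \<in> chart_dom c"
  shows "chart_inv c (chart_map c y) = y"
proof -
  have h: "homeomorphic_map (subtopology (mtop M) (chart_dom c)) (top_of_set (chart_map c ` chart_dom c))
      (chart_map c)"
    using atlas_is_chart[OF assms(1,2)] by (simp add: is_chart_def)
  have "topspace (mtop M) \<inter> chart_dom c = chart_dom c"
    using openin_subset[OF chart_dom_open[OF assms(1,2)]] by blast
  then have "inj_on (chart_map c) (chart_dom c)"
    using homeomorphic_imp_injective_map[OF h] by simp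
  then show ?thesis
    using assms(3) by (simp add: chart_inv_def inv_into_f_f)
qed

lemma open_chart_image:
  assumes "smooth_manifold M" "c \<in> atlas M" "openin (mtop M) U" "U \<subseteq> chart_dom c"
  shows "open (chart_map c ` U)"
proof -
  have h: "homeomorphic_map (subtopology (mtop M) (chart_dom c)) (top_of_set (chart_map c ` chart_dom c))
      (chart_map c)" and o: "open (chart_map c ` chart_dom c)"
    using atlas_is_chart[OF assms(1,2)] by (simp_all add: is_chart_def)
  have "openin (subtopology (mtop M) (chart_dom c)) U"
    using assms(3,4) by (auto simp: openin_subtopology)
  then have "openin (top_of_set (chart_map c ` chart_dom c)) (chart_map c ` U)"
    using homeomorphic_imp_open_map[OF h] by (simp add: open_map_def)
  then show ?thesis
    using o openin_open_eq by blast
qed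

lemma chart_at_mem:
  assumes "smooth_manifold M" "x \<in> topspace (mtop M)"
  shows "chart_at M x \<in> atlas M" "x \<in> chart_dom (chart_at M x)"
proof -
  have "\<exists>c. c \<in> atlas M \<and> x \<in> chart_dom c"
    using assms by (auto simp: smooth_manifold_def)
  then have "chart_at M x \<in> atlas M \<and> x \<in> chart_dom (chart_at M x)"
    unfolding chart_at_def by (rule someI_ex)
  then show "chart_at M x \<in> atlas M" "x \<in> chart_dom (chart_at M x)"
    by auto
qed

lemma chart_dom_subset: "smooth_manifold M \<Longrightarrow> c \<in> atlas M \<Longrightarrow> y \<in> chart_dom c \<Longrightarrow> y \<in> topspace (mtop M)"
  using chart_dom_open openin_subset by blast

lemma smooth_map_ident: "smooth_manifold M \<Longrightarrow> smooth_map M M (\<lambda>x. x)"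
  by (auto simp: smooth_map_def smooth_manifold_def o_def vimage_def)

lemma openin_preimage:
  assumes "smooth_map M N \<phi>" "openin (mtop M) U" "openin (mtop N) W"
  shows "openin (mtop M) (U \<inter> \<phi> -` W)"
proof -
  have "openin (mtop M) {x \<in> topspace (mtop M). \<phi> x \<in> W}"
    using assms by (auto simp: smooth_map_def intro: openin_continuous_map_preimage)
  moreover have "U \<inter> \<phi> -` W = U \<inter> {x \<in> topspace (mtop M). \<phi> x \<in> W}"
    using openin_subset[OF assms(2)] by blast
  ultimately show ?thesis
    using assms(2) by (simp add: openin_Int)
qed

lemma smooth_map_topspace: "smooth_map M N \<phi> \<Longrightarrow> x \<in> topspace (mtop M) \<Longrightarrow> \<phi> x \<in> topspace (mtop N)"
  by (auto simp: smooth_map_def continuous_map_def)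

text \<open>The Jacobian of \<phi> at \<open>y\<close> in the charts \<open>c\<close> and
  \<open>d\<close>. Since \<open>vec_in\<close>, \<open>extend_vec\<close> and
  \<open>differential\<close> are all of this form, the first two with the identity map, one chain
  rule serves both for changes of chart and for differentials.\<close>

definition map_deriv ::
    "('a \<Rightarrow> 'b) \<Rightarrow> ('a, 'e::euclidean_space) chart \<Rightarrow> ('b, 'f::euclidean_space) chart \<Rightarrow> 'a \<Rightarrow> 'e \<Rightarrow> 'f"
  where "map_deriv \<phi> c d y = frechet_derivative (chart_map d \<circ> \<phi> \<circ> chart_inv c) (at (chart_map c y))"

lemma vec_in_eq: "vec_in M c x = map_deriv (\<lambda>x. x) (chart_at M x) c x"
  by (simp add: vec_in_def map_deriv_def o_def fun_eq_iff)

lemma extend_vec_eq: "extend_vec M x v y = map_deriv (\<lambda>x. x) (chart_at M x) (chart_at M y) y v"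
  by (simp add: extend_vec_def map_deriv_def o_def)

lemma differential_eq: "differential M N \<phi> x = map_deriv \<phi> (chart_at M x) (chart_at N (\<phi> x)) x"
  by (simp add: differential_def map_deriv_def fun_eq_iff)

lemma smooth_rep:
  assumes "smooth_map M N \<phi>" "c \<in> atlas M" "d \<in> atlas N"
  shows "smooth_on (chart_map c ` (chart_dom c \<inter> \<phi> -` chart_dom d)) (chart_map d \<circ> \<phi> \<circ> chart_inv c)"
  using assms by (simp add: smooth_map_def)

lemma open_rep_domain:
  assumes "smooth_manifold M" "smooth_manifold N" "smooth_map M N \<phi>" "c \<in> atlas M" "d \<in> atlas N"
    and "openin (mtop M) U"
  shows "open (chart_map c ` (chart_dom c \<inter> U \<inter> \<phi> -` chart_dom d))"
proof (rule open_chart_image[OF assms(1,4)])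
  show "openin (mtop M) (chart_dom c \<inter> U \<inter> \<phi> -` chart_dom d)"
    using openin_preimage[OF assms(3) openin_Int[OF chart_dom_open[OF assms(1,4)] assms(6)]
        chart_dom_open[OF assms(2,5)]] .
qed blast

lemma rep_differentiable:
  assumes "smooth_map M N \<phi>" "c \<in> atlas M" "d \<in> atlas N" "y \<in> chart_dom c" "\<phi> y \<in> chart_dom d"
  shows "(chart_map d \<circ> \<phi> \<circ> chart_inv c) differentiable (at (chart_map c y))"
  by (rule smooth_on_imp_differentiable[OF smooth_rep[OF assms(1-3)]]) (use assms(4,5) in blast)

lemma map_deriv_linear:
  assumes "smooth_map M N \<phi>" "c \<in> atlas M" "d \<in> atlas N" "y \<in> chart_dom c" "\<phi> y \<in> chart_dom d"
  shows "linear (map_deriv \<phi> c d y)"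
  unfolding map_deriv_def using linear_frechet_derivative[OF rep_differentiable[OF assms]] .

text \<open>The composite of the two coordinate representations agrees with the representation of
  the composite only where \<phi> maps into \<open>chart_dom d\<close>, because
  \<open>chart_inv d\<close> undoes \<open>chart_map d\<close> only there. That set is open, so the
  derivatives agree.\<close>

lemma map_deriv_compose:
  assumes M: "smooth_manifold M" and N: "smooth_manifold N"
    and \<phi>: "smooth_map M N \<phi>" and \<psi>: "smooth_map N P \<psi>"
    and c: "c \<in> atlas M" "y \<in> chart_dom c" and d: "d \<in> atlas N" "\<phi> y \<in> chart_dom d"
    and e: "e \<in> atlas P" "\<psi> (\<phi> y) \<in> chart_dom e"
  shows "map_deriv (\<lambda>x. \<psi> (\<phi> x)) c e y v = map_deriv \<psi> d e (\<phi> y) (map_deriv \<phi> c d y v)"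
proof -
  let ?f = "chart_map d \<circ> \<phi> \<circ> chart_inv c" and ?g = "chart_map e \<circ> \<psi> \<circ> chart_inv d"
  let ?S = "chart_map c ` (chart_dom c \<inter> \<phi> -` chart_dom d)"
  have fy: "?f (chart_map c y) = chart_map d (\<phi> y)"
    using M c by simp
  have f: "?f differentiable (at (chart_map c y))"
    by (rule rep_differentiable[OF \<phi> c(1) d(1) c(2) d(2)])
  have g: "?g differentiable (at (?f (chart_map c y)))"
    unfolding fy by (rule rep_differentiable[OF \<psi> d(1) e(1) d(2) e(2)])
  have "frechet_derivative (?g \<circ> ?f) (at (chart_map c y))
      = frechet_derivative (chart_map e \<circ> (\<lambda>x. \<psi> (\<phi> x)) \<circ> chart_inv c) (at (chart_map c y))"
  proof (rule frechet_derivative_transform_within_open)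
    show "(?g \<circ> ?f) differentiable (at (chart_map c y))"
      using f g by (rule differentiable_chain_at)
    show "open ?S"
      using open_rep_domain[OF M N \<phi> c(1) d(1) openin_topspace]
        openin_subset[OF chart_dom_open[OF M c(1)]] by (simp add: Int_absorb2)
    show "chart_map c y \<in> ?S"
      using c d by blast
    show "(?g \<circ> ?f) z = (chart_map e \<circ> (\<lambda>x. \<psi> (\<phi> x)) \<circ> chart_inv c) z" if "z \<in> ?S" for z
      using that M N c d by auto
  qed
  then show ?thesis
    unfolding map_deriv_def frechet_derivative_compose[OF f g] fy[symmetric] by (metis comp_apply)
qed

lemma map_deriv_ident [simp]:
  assumes "smooth_manifold M" "c \<in> atlas M" "y \<in> chart_dom c"
  shows "map_deriv (\<lambda>x. x) c c y v = v"
proof -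
  have "frechet_derivative (\<lambda>z. z) (at (chart_map c y))
      = frechet_derivative (chart_map c \<circ> (\<lambda>x. x) \<circ> chart_inv c) (at (chart_map c y))"
  proof (rule frechet_derivative_transform_within_open)
    show "open (chart_map c ` chart_dom c)"
      using open_chart_image[OF assms(1,2) chart_dom_open[OF assms(1,2)]] by simp
  qed (use assms in auto)
  from fun_cong[OF this, of v] show ?thesis
    by (simp add: map_deriv_def)
qed

section \<open>Tangent vectors and differentials in arbitrary charts\<close>

lemma vec_in_linear:
  assumes "smooth_manifold M" "c \<in> atlas M" "y \<in> chart_dom c"
  shows "linear (vec_in M c y)"
proof -
  note d = chart_at_mem[OF assms(1) chart_dom_subset[OF assms]]
  show ?thesis
    unfolding vec_in_eq
    by (rule map_deriv_linear[OF smooth_map_ident[OF assms(1)] d(1) assms(2) d(2) assms(3)])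
qed

lemma vec_in_chart_at [simp]:
  assumes "smooth_manifold M" "x \<in> topspace (mtop M)"
  shows "vec_in M (chart_at M x) x v = v"
  using assms by (simp add: vec_in_eq chart_at_mem)

lemma vec_in_change_chart:
  assumes "smooth_manifold M" "c \<in> atlas M" "y \<in> chart_dom c" "d \<in> atlas M" "y \<in> chart_dom d"
  shows "vec_in M d y v = map_deriv (\<lambda>x. x) c d y (vec_in M c y v)"
proof -
  note i = smooth_map_ident[OF assms(1)]
  note b = chart_at_mem[OF assms(1) chart_dom_subset[OF assms(1-3)]]
  show ?thesis
    unfolding vec_in_eq by (rule map_deriv_compose[OF assms(1,1) i i b assms(2-5)])
qed

lemma vec_in_extend_vec:
  assumes "smooth_manifold M" "x \<in> topspace (mtop M)"
    and "c \<in> atlas M" "y \<in> chart_dom c" "y \<in> chart_dom (chart_at M x)"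
  shows "vec_in M c y (extend_vec M x v y) = map_deriv (\<lambda>x. x) (chart_at M x) c y v"
proof -
  note i = smooth_map_ident[OF assms(1)]
  note a = chart_at_mem(1)[OF assms(1,2)]
  note b = chart_at_mem[OF assms(1) chart_dom_subset[OF assms(1,3,4)]]
  show ?thesis
    unfolding vec_in_eq extend_vec_eq
    by (rule map_deriv_compose[OF assms(1,1) i i a assms(5) b assms(3,4), symmetric])
qed

lemma extend_vec_vec_in:
  assumes "smooth_manifold M" "x \<in> topspace (mtop M)" "y \<in> chart_dom (chart_at M x)"
  shows "extend_vec M x (vec_in M (chart_at M x) y v) y = v"
proof -
  have c: "chart_at M x \<in> atlas M"
    using chart_at_mem[OF assms(1,2)] by blast
  note y = chart_dom_subset[OF assms(1) c assms(3)]
  note d = chart_at_mem[OF assms(1) y]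
  show ?thesis
    unfolding extend_vec_eq
    unfolding vec_in_change_chart[OF assms(1) c assms(3) d, symmetric] vec_in_chart_at[OF assms(1) y] ..
qed

lemma extend_vec_linear:
  assumes "smooth_manifold M" "x \<in> topspace (mtop M)" "y \<in> chart_dom (chart_at M x)"
  shows "linear (\<lambda>v. extend_vec M x v y)"
proof -
  have c: "chart_at M x \<in> atlas M"
    using chart_at_mem[OF assms(1,2)] by blast
  note d = chart_at_mem[OF assms(1) chart_dom_subset[OF assms(1) c assms(3)]]
  show ?thesis
    unfolding extend_vec_eq
    using map_deriv_linear[OF smooth_map_ident[OF assms(1)] c d(1) assms(3) d(2)] by simp
qed

lemma extend_vec_self [simp]:
  "smooth_manifold M \<Longrightarrow> x \<in> topspace (mtop M) \<Longrightarrow> extend_vec M x v x = v"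
  by (simp add: extend_vec_eq chart_at_mem)

text \<open>Both sides are the Jacobian from the chosen chart at \<open>y\<close> to
  \<open>d\<close>, factored once through the chosen chart at \<open>\<phi> y\<close> and once
  through \<open>c\<close>.\<close>

lemma vec_in_differential:
  assumes "smooth_manifold M" "smooth_manifold N" "smooth_map M N \<phi>"
    and "c \<in> atlas M" "y \<in> chart_dom c" "d \<in> atlas N" "\<phi> y \<in> chart_dom d"
  shows "vec_in N d (\<phi> y) (differential M N \<phi> y v) = map_deriv \<phi> c d y (vec_in M c y v)"
proof -
  note c' = chart_at_mem[OF assms(1) chart_dom_subset[OF assms(1,4,5)]]
  note d' = chart_at_mem[OF assms(2) chart_dom_subset[OF assms(2,6,7)]]
  have "map_deriv \<phi> (chart_at M y) d y v = vec_in N d (\<phi> y) (differential M N \<phi> y v)"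
    unfolding vec_in_eq differential_eq
    using map_deriv_compose[OF assms(1-3) smooth_map_ident[OF assms(2)] c' d' assms(6,7)] .
  moreover have "map_deriv \<phi> (chart_at M y) d y v = map_deriv \<phi> c d y (vec_in M c y v)"
    unfolding vec_in_eq
    using map_deriv_compose[OF assms(1,1) smooth_map_ident[OF assms(1)] assms(3) c' assms(4,5,6,7)] .
  ultimately show ?thesis by simp
qed

lemma differential_linear:
  assumes "smooth_manifold M" "smooth_manifold N" "smooth_map M N \<phi>" "y \<in> topspace (mtop M)"
  shows "linear (differential M N \<phi> y)"
proof -
  note c = chart_at_mem[OF assms(1,4)]
  note d = chart_at_mem[OF assms(2) smooth_map_topspace[OF assms(3,4)]]
  show ?thesis
    unfolding differential_eq by (rule map_deriv_linear[OF assms(3) c(1) d(1) c(2) d(2)])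
qed

lemma differential_ident:
  assumes "smooth_manifold M" "x \<in> topspace (mtop M)"
  shows "differential M M (\<lambda>x. x) x v = v"
  using assms by (simp add: differential_eq chart_at_mem)

section \<open>Smooth functions on manifolds\<close>

lemma smooth_fun_const: "smooth_fun M U (\<lambda>x. r)"
  by (simp add: smooth_fun_def o_def smooth_on_const)

lemma vector_fields_subset: "X \<in> vector_fields M U \<Longrightarrow> U' \<subseteq> U \<Longrightarrow> X \<in> vector_fields M U'"
  unfolding vector_fields_def by (auto intro: smooth_on_subset)

lemma smooth_fun_differentiable:
  assumes "smooth_fun M U f" "c \<in> atlas M" "y \<in> chart_dom c" "y \<in> U"
  shows "(f \<circ> chart_inv c) differentiable (at (chart_map c y))"
  using assms by (intro smooth_on_imp_differentiable[of "chart_map c ` (chart_dom c \<inter> U)"])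
    (auto simp: smooth_fun_def)

text \<open>\<open>dir_deriv\<close> uses the chosen chart at \<open>y\<close>, which varies with
  \<open>y\<close>. A formula in one fixed chart is required before the result can be differentiated
  again.\<close>

lemma dir_deriv_in_chart:
  assumes M: "smooth_manifold M" and U: "openin (mtop M) U" and f: "smooth_fun M U f"
    and c: "c \<in> atlas M" "y \<in> chart_dom c" and y: "y \<in> U"
  shows "dir_deriv M f y v = frechet_derivative (f \<circ> chart_inv c) (at (chart_map c y)) (vec_in M c y v)"
proof -
  let ?d = "chart_at M y"
  note d = chart_at_mem[OF M chart_dom_subset[OF M c]]
  let ?h = "chart_map c \<circ> (\<lambda>x. x) \<circ> chart_inv ?d" and ?g = "f \<circ> chart_inv c"
  let ?S = "chart_map ?d ` (chart_dom ?d \<inter> U \<inter> (\<lambda>x. x) -` chart_dom c)"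
  have hy: "?h (chart_map ?d y) = chart_map c y"
    using M d by simp
  have h: "?h differentiable (at (chart_map ?d y))"
    using rep_differentiable[OF smooth_map_ident[OF M] d(1) c(1) d(2) c(2)] .
  have g: "?g differentiable (at (?h (chart_map ?d y)))"
    unfolding hy by (rule smooth_fun_differentiable[OF f c y])
  have "frechet_derivative (?g \<circ> ?h) (at (chart_map ?d y))
      = frechet_derivative (f \<circ> chart_inv ?d) (at (chart_map ?d y))"
  proof (rule frechet_derivative_transform_within_open)
    show "(?g \<circ> ?h) differentiable (at (chart_map ?d y))"
      using h g by (rule differentiable_chain_at)
    show "open ?S"
      by (rule open_rep_domain[OF M M smooth_map_ident[OF M] d(1) c(1) U])
    show "chart_map ?d y \<in> ?S"
      using c d y by blast
    show "(?g \<circ> ?h) z = (f \<circ> chart_inv ?d) z" if "z \<in> ?S" for z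
      using that M c d by auto
  qed
  then show ?thesis
    unfolding dir_deriv_def vec_in_eq map_deriv_def frechet_derivative_compose[OF h g] hy[symmetric]
    by (metis comp_apply)
qed

lemma dir_deriv_const: "dir_deriv M (\<lambda>x. r) x v = 0"
  by (simp add: dir_deriv_def o_def)

text \<open>In the chart at \<open>x\<close>, differentiating along \<open>Y\<close> and then along
  \<open>X\<close> gives the Hessian of \<open>f\<close> on the pair plus the derivative of
  \<open>f\<close> in the direction in which the coordinates of \<open>Y\<close> change along
  \<open>X\<close>. The Hessian is symmetric and cancels; what remains is the coordinate formula of
  the bracket.\<close>

lemma dir_deriv_commutator:
  assumes M: "smooth_manifold M" and U: "openin (mtop M) U" and f: "smooth_fun M U f"
    and X: "X \<in> vector_fields M U" and Y: "Y \<in> vector_fields M U" and x: "x \<in> U"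
  shows "dir_deriv M (\<lambda>y. dir_deriv M f y (Y y)) x (X x) - dir_deriv M (\<lambda>y. dir_deriv M f y (X y)) x (Y x)
    = dir_deriv M f x (lie_bracket M X Y x)"
proof -
  define c where "c = chart_at M x"
  have xM: "x \<in> topspace (mtop M)"
    using x openin_subset[OF U] by blast
  have c: "c \<in> atlas M" "x \<in> chart_dom c"
    using chart_at_mem[OF M xM] by (simp_all add: c_def)
  define S where "S = chart_map c ` (chart_dom c \<inter> U)"
  have S: "open S"
    unfolding S_def using open_chart_image[OF M c(1) openin_Int[OF chart_dom_open[OF M c(1)] U]] by simp
  define z where "z = chart_map c x"
  have z: "z \<in> S"
    using x c by (auto simp: S_def z_def)
  define F where "F = f \<circ> chart_inv c"
  define coords where "coords Z = (\<lambda>y. vec_in M c y (Z y)) \<circ> chart_inv c" for Z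
  have F: "smooth_on S F"
    using f c by (simp add: smooth_fun_def F_def S_def)
  have coords: "smooth_on S (coords Z)" if "Z \<in> vector_fields M U" for Z
    using that c by (simp add: vector_fields_def coords_def S_def)
  have at_z: "coords Z z = Z x" for Z
    using c xM M by (simp add: coords_def z_def) (simp add: c_def)
  have first: "dir_deriv M f x v = frechet_derivative F (at z) v" for v
    by (simp add: dir_deriv_def F_def z_def c_def)
  have second: "dir_deriv M (\<lambda>y. dir_deriv M f y (Y y)) x (X x)
      = frechet_derivative F (at z) (frechet_derivative (coords Y) (at z) (X x))
        + (\<Sum>a\<in>Basis. \<Sum>b\<in>Basis. (X x \<bullet> a) * (Y x \<bullet> b) *
            frechet_derivative (\<lambda>w. frechet_derivative F (at w) b) (at z) a)"
    if X: "X \<in> vector_fields M U" and Y: "Y \<in> vector_fields M U" for X Y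
  proof -
    \<comment> \<open>The coordinate form on \<open>S\<close> of the derivative of \<open>f\<close>
      along \<open>Y\<close>, expanded in the basis to expose the products to be
      differentiated.\<close>
    let ?G = "\<lambda>w. \<Sum>b\<in>Basis. (coords Y w \<bullet> b) * frechet_derivative F (at w) b"
    let ?DF = "\<lambda>b w. frechet_derivative F (at w) b"
    have lin: "linear (frechet_derivative F (at w))" if "w \<in> S" for w
      using smooth_on_imp_differentiable[OF F that] by (rule linear_frechet_derivative)
    have dY: "(coords Y has_derivative frechet_derivative (coords Y) (at z)) (at z)"
      using smooth_on_imp_differentiable[OF coords[OF Y] z] frechet_derivative_works by blast
    have dF: "(?DF b has_derivative frechet_derivative (?DF b) (at z)) (at z)" for b
      using smooth_on_imp_differentiable[OF smooth_on_partial[OF F] z] frechet_derivative_works by blast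
    have G: "(?G has_derivative (\<lambda>v. \<Sum>b\<in>Basis. (coords Y z \<bullet> b) * frechet_derivative (?DF b) (at z) v
        + (frechet_derivative (coords Y) (at z) v \<bullet> b) * ?DF b z)) (at z)"
      by (intro has_derivative_sum has_derivative_mult dF has_derivative_inner_left dY)
    have "((\<lambda>y. dir_deriv M f y (Y y)) \<circ> chart_inv c) w = ?G w" if w: "w \<in> S" for w
    proof -
      obtain y where y: "y \<in> chart_dom c" "y \<in> U" "w = chart_map c y"
        using w by (auto simp: S_def)
      then show ?thesis
        using dir_deriv_in_chart[OF M U f c(1) y(1,2)] M c
          linear_basis_expansion[OF lin[OF w], of "coords Y w"]
        by (simp add: coords_def F_def)
    qed
    then have "frechet_derivative ?G (at z)
        = frechet_derivative ((\<lambda>y. dir_deriv M f y (Y y)) \<circ> chart_inv c) (at z)"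
      using G S z by (intro frechet_derivative_transform_within_open[of _ _ S]) (auto simp: differentiable_def)
    then have "dir_deriv M (\<lambda>y. dir_deriv M f y (Y y)) x (X x) = frechet_derivative ?G (at z) (X x)"
      by (simp add: dir_deriv_def z_def c_def)
    also have "\<dots> = (\<Sum>b\<in>Basis. (Y x \<bullet> b) * frechet_derivative (?DF b) (at z) (X x))
        + (\<Sum>b\<in>Basis. (frechet_derivative (coords Y) (at z) (X x) \<bullet> b) * ?DF b z)"
      unfolding frechet_derivative_at[OF G, symmetric] by (simp add: at_z sum.distrib)
    also have "(\<Sum>b\<in>Basis. (frechet_derivative (coords Y) (at z) (X x) \<bullet> b) * ?DF b z)
        = frechet_derivative F (at z) (frechet_derivative (coords Y) (at z) (X x))"
      using linear_basis_expansion[OF lin[OF z], of "frechet_derivative (coords Y) (at z) (X x)"] by simp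
    also have "(\<Sum>b\<in>Basis. (Y x \<bullet> b) * frechet_derivative (?DF b) (at z) (X x))
        = (\<Sum>b\<in>Basis. \<Sum>a\<in>Basis. (X x \<bullet> a) * (Y x \<bullet> b) * frechet_derivative (?DF b) (at z) a)"
    proof (rule sum.cong)
      fix b :: 'b assume "b \<in> Basis"
      have "linear (frechet_derivative (?DF b) (at z))"
        using dF has_derivative_linear by blast
      then show "(Y x \<bullet> b) * frechet_derivative (?DF b) (at z) (X x)
          = (\<Sum>a\<in>Basis. (X x \<bullet> a) * (Y x \<bullet> b) * frechet_derivative (?DF b) (at z) a)"
        using linear_basis_expansion[of "frechet_derivative (?DF b) (at z)" "X x"]
        by (simp add: sum_distrib_left ac_simps)
    qed simp
    also have "(\<Sum>b\<in>Basis. \<Sum>a\<in>Basis. (X x \<bullet> a) * (Y x \<bullet> b) * frechet_derivative (?DF b) (at z) a)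
        = (\<Sum>a\<in>Basis. \<Sum>b\<in>Basis. (X x \<bullet> a) * (Y x \<bullet> b) * frechet_derivative (?DF b) (at z) a)"
      by (rule sum.swap)
    finally show ?thesis
      by simp
  qed
  have sym: "(\<Sum>a\<in>Basis. \<Sum>b\<in>Basis. (X x \<bullet> a) * (Y x \<bullet> b) *
            frechet_derivative (\<lambda>w. frechet_derivative F (at w) b) (at z) a)
        = (\<Sum>a\<in>Basis. \<Sum>b\<in>Basis. (Y x \<bullet> a) * (X x \<bullet> b) *
            frechet_derivative (\<lambda>w. frechet_derivative F (at w) b) (at z) a)"
    by (subst sum.swap, intro sum.cong refl, subst second_derivative_symmetric[OF S z F])
      (simp add: mult.commute)
  have "linear (frechet_derivative F (at z))"
    using smooth_on_imp_differentiable[OF F z] by (rule linear_frechet_derivative)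
  moreover have "lie_bracket M X Y x
      = frechet_derivative (coords Y) (at z) (X x) - frechet_derivative (coords X) (at z) (Y x)"
    by (simp add: lie_bracket_def coords_def z_def c_def Let_def)
  ultimately show ?thesis
    unfolding second[OF X Y] second[OF Y X] first sym by (simp add: linear_diff)
qed

section \<open>Sections along a smooth map\<close>

locale smooth_setting =
  fixes M :: "('a, 'e::euclidean_space, 'y) manifold_scheme"
    and N :: "('b, 'f::euclidean_space, 'z) manifold_scheme"
    and \<phi> :: "'a \<Rightarrow> 'b"
  assumes M: "smooth_manifold M" and N: "smooth_manifold N" and \<phi>: "smooth_map M N \<phi>"
begin

abbreviation "\<Gamma> \<equiv> sections_along M N \<phi>"
abbreviation "\<XX> \<equiv> vector_fields M"
abbreviation "open_in \<equiv> openin (mtop M)"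
abbreviation "d\<phi> \<equiv> differential M N \<phi>"

text \<open>Membership asks for smoothness of a composite with \<open>chart_inv\<close>. Any smooth
  expression \<open>h\<close> with the right values at chart points will do, since the coordinate
  domain is open.\<close>

lemma sectionI:
  assumes U: "open_in U"
    and "\<And>c d. c \<in> atlas M \<Longrightarrow> d \<in> atlas N \<Longrightarrow>
      \<exists>h. smooth_on (chart_map c ` (chart_dom c \<inter> U \<inter> \<phi> -` chart_dom d)) h \<and>
        (\<forall>y. y \<in> chart_dom c \<and> y \<in> U \<and> \<phi> y \<in> chart_dom d \<longrightarrow> h (chart_map c y) = vec_in N d (\<phi> y) (V y))"
  shows "V \<in> \<Gamma> U"
  unfolding sections_along_def
proof (clarify)
  fix c d assume c: "c \<in> atlas M" and d: "d \<in> atlas N"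
  then obtain h where h: "smooth_on (chart_map c ` (chart_dom c \<inter> U \<inter> \<phi> -` chart_dom d)) h"
    "\<And>y. y \<in> chart_dom c \<Longrightarrow> y \<in> U \<Longrightarrow> \<phi> y \<in> chart_dom d \<Longrightarrow> h (chart_map c y) = vec_in N d (\<phi> y) (V y)"
    using assms(2) by meson
  show "smooth_on (chart_map c ` (chart_dom c \<inter> U \<inter> \<phi> -` chart_dom d))
      ((\<lambda>x. vec_in N d (\<phi> x) (V x)) \<circ> chart_inv c)"
    by (rule smooth_on_cong[OF open_rep_domain[OF M N \<phi> c d U] _ h(1)]) (use h(2) M c in auto)
qed

lemma sectionD:
  assumes "V \<in> \<Gamma> U" "c \<in> atlas M" "d \<in> atlas N"
  shows "smooth_on (chart_map c ` (chart_dom c \<inter> U \<inter> \<phi> -` chart_dom d))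
      ((\<lambda>x. vec_in N d (\<phi> x) (V x)) \<circ> chart_inv c)"
  using assms by (simp add: sections_along_def)

lemma section_cong:
  assumes "open_in U" "V \<in> \<Gamma> U" "\<And>y. y \<in> U \<Longrightarrow> V y = W y"
  shows "W \<in> \<Gamma> U"
proof (rule sectionI[OF assms(1)], intro exI conjI)
  show "smooth_on (chart_map c ` (chart_dom c \<inter> U \<inter> \<phi> -` chart_dom d))
      ((\<lambda>x. vec_in N d (\<phi> x) (V x)) \<circ> chart_inv c)" if "c \<in> atlas M" "d \<in> atlas N" for c d
    by (rule sectionD[OF assms(2) that])
qed (use assms(3) M in auto)

lemma section_subset:
  assumes "V \<in> \<Gamma> U" "U' \<subseteq> U"
  shows "V \<in> \<Gamma> U'"
  using assms(1) unfolding sections_along_def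
  by clarify (rule smooth_on_subset, blast, use assms(2) in blast)

lemma section_add:
  assumes U: "open_in U" and V: "V \<in> \<Gamma> U" and W: "W \<in> \<Gamma> U"
  shows "(\<lambda>y. V y + W y) \<in> \<Gamma> U"
proof (rule sectionI[OF U], intro exI conjI)
  fix c d assume c: "c \<in> atlas M" and d: "d \<in> atlas N"
  show "smooth_on (chart_map c ` (chart_dom c \<inter> U \<inter> \<phi> -` chart_dom d))
      (\<lambda>z. ((\<lambda>x. vec_in N d (\<phi> x) (V x)) \<circ> chart_inv c) z
         + ((\<lambda>x. vec_in N d (\<phi> x) (W x)) \<circ> chart_inv c) z)"
    by (rule smooth_on_add[OF open_rep_domain[OF M N \<phi> c d U] sectionD[OF V c d] sectionD[OF W c d]])
  show "\<forall>y. y \<in> chart_dom c \<and> y \<in> U \<and> \<phi> y \<in> chart_dom d \<longrightarrow>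
      ((\<lambda>x. vec_in N d (\<phi> x) (V x)) \<circ> chart_inv c) (chart_map c y)
      + ((\<lambda>x. vec_in N d (\<phi> x) (W x)) \<circ> chart_inv c) (chart_map c y) = vec_in N d (\<phi> y) (V y + W y)"
    using M c linear_add[OF vec_in_linear[OF N d]] by simp
qed

lemma section_scale:
  assumes U: "open_in U" and f: "smooth_fun M U f" and V: "V \<in> \<Gamma> U"
  shows "(\<lambda>y. f y *\<^sub>R V y) \<in> \<Gamma> U"
proof (rule sectionI[OF U], intro exI conjI)
  fix c d assume c: "c \<in> atlas M" and d: "d \<in> atlas N"
  have "smooth_on (chart_map c ` (chart_dom c \<inter> U)) (f \<circ> chart_inv c)"
    using f c by (simp add: smooth_fun_def)
  then have "smooth_on (chart_map c ` (chart_dom c \<inter> U \<inter> \<phi> -` chart_dom d)) (f \<circ> chart_inv c)"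
    by (rule smooth_on_subset) blast
  then show "smooth_on (chart_map c ` (chart_dom c \<inter> U \<inter> \<phi> -` chart_dom d))
      (\<lambda>z. (f \<circ> chart_inv c) z *\<^sub>R ((\<lambda>x. vec_in N d (\<phi> x) (V x)) \<circ> chart_inv c) z)"
    by (rule smooth_on_scaleR[OF open_rep_domain[OF M N \<phi> c d U] _ sectionD[OF V c d]])
  show "\<forall>y. y \<in> chart_dom c \<and> y \<in> U \<and> \<phi> y \<in> chart_dom d \<longrightarrow>
      (f \<circ> chart_inv c) (chart_map c y) *\<^sub>R ((\<lambda>x. vec_in N d (\<phi> x) (V x)) \<circ> chart_inv c) (chart_map c y)
        = vec_in N d (\<phi> y) (f y *\<^sub>R V y)"
    using M c linear_scale[OF vec_in_linear[OF N d]] by simp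
qed

lemma section_const_scale: "open_in U \<Longrightarrow> V \<in> \<Gamma> U \<Longrightarrow> (\<lambda>y. r *\<^sub>R V y) \<in> \<Gamma> U"
  by (rule section_scale[OF _ smooth_fun_const])

lemma section_diff:
  assumes "open_in U" "V \<in> \<Gamma> U" "W \<in> \<Gamma> U"
  shows "(\<lambda>y. V y - W y) \<in> \<Gamma> U"
  using section_add[OF assms(1,2) section_const_scale[OF assms(1,3), of "-1"]] by simp

lemma section_zero:
  assumes U: "open_in U"
  shows "(\<lambda>y. 0) \<in> \<Gamma> U"
proof (rule sectionI[OF U], intro exI conjI)
  show "smooth_on (chart_map c ` (chart_dom c \<inter> U \<inter> \<phi> -` chart_dom d)) (\<lambda>z. 0)" for c d
    by (rule smooth_on_const)
qed (use linear_0[OF vec_in_linear[OF N]] in auto)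

lemma section_sum:
  assumes "open_in U" "\<And>b. b \<in> B \<Longrightarrow> V b \<in> \<Gamma> U"
  shows "(\<lambda>y. \<Sum>b\<in>B. V b y) \<in> \<Gamma> U"
  using assms(2)
  by (induction B rule: infinite_finite_induct) (simp_all add: section_zero[OF assms(1)] section_add[OF assms(1)])

lemma differential_section:
  assumes U: "open_in U" and X: "X \<in> \<XX> U"
  shows "(\<lambda>y. d\<phi> y (X y)) \<in> \<Gamma> U"
proof (rule sectionI[OF U], intro exI conjI)
  fix c d assume c: "c \<in> atlas M" and d: "d \<in> atlas N"
  let ?S = "chart_map c ` (chart_dom c \<inter> U \<inter> \<phi> -` chart_dom d)"
  have "smooth_on (chart_map c ` (chart_dom c \<inter> U)) ((\<lambda>x. vec_in M c x (X x)) \<circ> chart_inv c)"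
    using X c by (simp add: vector_fields_def)
  then have "smooth_on ?S ((\<lambda>x. vec_in M c x (X x)) \<circ> chart_inv c)"
    by (rule smooth_on_subset) blast
  moreover have "smooth_on ?S (chart_map d \<circ> \<phi> \<circ> chart_inv c)"
    by (rule smooth_on_subset[OF smooth_rep[OF \<phi> c d]]) blast
  ultimately show "smooth_on ?S (\<lambda>z. frechet_derivative (chart_map d \<circ> \<phi> \<circ> chart_inv c) (at z)
      (((\<lambda>x. vec_in M c x (X x)) \<circ> chart_inv c) z))"
    by (intro smooth_on_derivative_apply open_rep_domain[OF M N \<phi> c d U])
  show "\<forall>y. y \<in> chart_dom c \<and> y \<in> U \<and> \<phi> y \<in> chart_dom d \<longrightarrow>
      frechet_derivative (chart_map d \<circ> \<phi> \<circ> chart_inv c) (at (chart_map c y))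
      (((\<lambda>x. vec_in M c x (X x)) \<circ> chart_inv c) (chart_map c y)) = vec_in N d (\<phi> y) (d\<phi> y (X y))"
    using M c vec_in_differential[OF M N \<phi> c _ d] by (simp add: map_deriv_def)
qed

lemma compose_section:
  assumes U: "open_in U" and W: "openin (mtop N) W" and E: "E \<in> vector_fields N W" and "\<phi> ` U \<subseteq> W"
  shows "(\<lambda>y. E (\<phi> y)) \<in> \<Gamma> U"
proof (rule sectionI[OF U], intro exI conjI)
  fix c d assume c: "c \<in> atlas M" and d: "d \<in> atlas N"
  let ?S = "chart_map c ` (chart_dom c \<inter> U \<inter> \<phi> -` chart_dom d)"
  let ?T = "chart_map d ` (chart_dom d \<inter> W)"
  show "smooth_on ?S (((\<lambda>x. vec_in N d x (E x)) \<circ> chart_inv d) \<circ> (chart_map d \<circ> \<phi> \<circ> chart_inv c))"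
  proof (rule smooth_on_compose)
    show "open ?T"
      by (rule open_chart_image[OF N d openin_Int[OF chart_dom_open[OF N d] W]]) blast
    show "(chart_map d \<circ> \<phi> \<circ> chart_inv c) ` ?S \<subseteq> ?T"
      using assms(4) M c by auto
    show "smooth_on ?T ((\<lambda>x. vec_in N d x (E x)) \<circ> chart_inv d)"
      using E d by (simp add: vector_fields_def)
    show "smooth_on ?S (chart_map d \<circ> \<phi> \<circ> chart_inv c)"
      by (rule smooth_on_subset[OF smooth_rep[OF \<phi> c d]]) blast
  qed (rule open_rep_domain[OF M N \<phi> c d U])
qed (use M N in auto)

section \<open>Coordinate functions of the map and the coordinate frame of the target\<close>

lemma chart_coordinate_smooth:
  assumes "d \<in> atlas N" "\<phi> ` U \<subseteq> chart_dom d" and U: "open_in U"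
  shows "smooth_fun M U (\<lambda>y. chart_map d (\<phi> y) \<bullet> b)"
  unfolding smooth_fun_def
proof
  fix c assume c: "c \<in> atlas M"
  have o: "open (chart_map c ` (chart_dom c \<inter> U))"
    by (rule open_chart_image[OF M c openin_Int[OF chart_dom_open[OF M c] U]]) blast
  have "smooth_on (chart_map c ` (chart_dom c \<inter> U)) (chart_map d \<circ> \<phi> \<circ> chart_inv c)"
    by (rule smooth_on_subset[OF smooth_rep[OF \<phi> c assms(1)]]) (use assms(2) in blast)
  then show "smooth_on (chart_map c ` (chart_dom c \<inter> U)) ((\<lambda>y. chart_map d (\<phi> y) \<bullet> b) \<circ> chart_inv c)"
    using smooth_on_linear_comp[OF o bounded_linear_inner_left] by (fastforce simp: o_def)
qed

lemma section_coefficient_smooth: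
  assumes "d \<in> atlas N" "\<phi> ` U \<subseteq> chart_dom d" and U: "open_in U" and V: "V \<in> \<Gamma> U"
  shows "smooth_fun M U (\<lambda>y. vec_in N d (\<phi> y) (V y) \<bullet> b)"
  unfolding smooth_fun_def
proof
  fix c assume c: "c \<in> atlas M"
  have o: "open (chart_map c ` (chart_dom c \<inter> U))"
    by (rule open_chart_image[OF M c openin_Int[OF chart_dom_open[OF M c] U]]) blast
  have "smooth_on (chart_map c ` (chart_dom c \<inter> U)) ((\<lambda>x. vec_in N d (\<phi> x) (V x)) \<circ> chart_inv c)"
    by (rule smooth_on_subset[OF sectionD[OF V c assms(1)]]) (use assms(2) in blast)
  then show "smooth_on (chart_map c ` (chart_dom c \<inter> U)) ((\<lambda>y. vec_in N d (\<phi> y) (V y) \<bullet> b) \<circ> chart_inv c)"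
    using smooth_on_linear_comp[OF o bounded_linear_inner_left] by (fastforce simp: o_def)
qed

text \<open>Identifies the components of the differential with derivatives of the scalar functions
  given by the coordinates of \<phi>, so that \<open>dir_deriv_commutator\<close> can be used on
  them.\<close>

lemma chart_coordinate_dir_deriv:
  assumes d: "d \<in> atlas N" "\<phi> y \<in> chart_dom d" and y: "y \<in> topspace (mtop M)"
  shows "dir_deriv M (\<lambda>y. chart_map d (\<phi> y) \<bullet> b) y v = vec_in N d (\<phi> y) (d\<phi> y v) \<bullet> b"
proof -
  note c = chart_at_mem[OF M y]
  let ?c = "chart_at M y"
  have "((chart_map d \<circ> \<phi> \<circ> chart_inv ?c) has_derivative map_deriv \<phi> ?c d y) (at (chart_map ?c y))"
    using rep_differentiable[OF \<phi> c(1) d(1) c(2) d(2)] by (simp add: map_deriv_def frechet_derivative_works)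
  then have "((\<lambda>z. (chart_map d \<circ> \<phi> \<circ> chart_inv ?c) z \<bullet> b) has_derivative
      (\<lambda>v. map_deriv \<phi> ?c d y v \<bullet> b)) (at (chart_map ?c y))"
    by (rule has_derivative_inner_left)
  from fun_cong[OF frechet_derivative_at[OF this], of v] show ?thesis
    using vec_in_differential[OF M N \<phi> c d] M y by (simp add: dir_deriv_def o_def)
qed

text \<open>In a chart \<open>c\<close> the field is a partial derivative, in the fixed direction
  \<open>v\<close>, of the transition map into \<open>c\<close>, evaluated after the inverse
  transition map; both ingredients are smooth.\<close>

lemma extend_vec_vector_field:
  assumes z: "z \<in> topspace (mtop N)"
  shows "extend_vec N z v \<in> vector_fields N (chart_dom (chart_at N z))"
  unfolding vector_fields_def
proof (clarify)
  fix c assume c: "c \<in> atlas N"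
  let ?d = "chart_at N z"
  note d = chart_at_mem[OF N z]
  note i = smooth_map_ident[OF N]
  let ?S = "chart_map c ` (chart_dom c \<inter> chart_dom ?d)"
  let ?T = "chart_map ?d ` (chart_dom ?d \<inter> chart_dom c)"
  have o: "open ?S"
    by (rule open_chart_image[OF N c openin_Int[OF chart_dom_open[OF N c] chart_dom_open[OF N d(1)]]]) blast
  have o': "open ?T"
    by (rule open_chart_image[OF N d(1) openin_Int[OF chart_dom_open[OF N d(1)] chart_dom_open[OF N c]]]) blast
  let ?h = "\<lambda>z. frechet_derivative (chart_map c \<circ> (\<lambda>x. x) \<circ> chart_inv ?d) (at z) v"
  have "smooth_on ?S (?h \<circ> (chart_map ?d \<circ> (\<lambda>x. x) \<circ> chart_inv c))"
  proof (rule smooth_on_compose[OF o o'])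
    show "smooth_on ?T ?h"
      using smooth_on_partial[OF smooth_rep[OF i d(1) c]] by (simp add: vimage_def)
    show "smooth_on ?S (chart_map ?d \<circ> (\<lambda>x. x) \<circ> chart_inv c)"
      using smooth_rep[OF i c d(1)] by (simp add: vimage_def)
  qed (use N c in auto)
  then show "smooth_on ?S ((\<lambda>y. vec_in N c y (extend_vec N z v y)) \<circ> chart_inv c)"
  proof (rule smooth_on_cong[OF o, rotated])
    fix w assume "w \<in> ?S"
    then obtain y where y: "y \<in> chart_dom c" "y \<in> chart_dom ?d" "w = chart_map c y"
      by blast
    show "(?h \<circ> (chart_map ?d \<circ> (\<lambda>x. x) \<circ> chart_inv c)) w
        = ((\<lambda>y. vec_in N c y (extend_vec N z v y)) \<circ> chart_inv c) w"
      using y vec_in_extend_vec[OF N z c y(1,2)] N c by (simp add: map_deriv_def)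
  qed
qed

text \<open>Over the chart domain, \<open>extend_vec N z\<close> rebuilds a vector from its
  coordinates in the chart at \<open>z\<close> and is linear in them; the coefficients are therefore
  those coordinates.\<close>

lemma section_frame_expansion:
  assumes z: "z \<in> topspace (mtop N)" and y: "\<phi> y \<in> chart_dom (chart_at N z)"
  shows "w = (\<Sum>b\<in>Basis. (vec_in N (chart_at N z) (\<phi> y) w \<bullet> b) *\<^sub>R extend_vec N z b (\<phi> y))"
  using linear_basis_expansion[OF extend_vec_linear[OF N z y], of "vec_in N (chart_at N z) (\<phi> y) w"]
  unfolding extend_vec_vec_in[OF N z y] .

end

text \<open>Makes everything proved for sections along a map available for vector fields, with the
  identity as the map. A vector field is tested in one chart and a section in two;
  \<open>differential_section\<close> for the identity bridges the difference.\<close>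

lemma vector_fields_eq_sections:
  assumes M: "smooth_manifold M" and U: "openin (mtop M) U"
  shows "vector_fields M U = sections_along M M (\<lambda>x. x) U"
proof -
  interpret smooth_setting M M "\<lambda>x. x"
    using M smooth_map_ident by unfold_locales
  show ?thesis
  proof (intro equalityI subsetI)
    fix X assume "X \<in> \<XX> U"
    then have "(\<lambda>y. d\<phi> y (X y)) \<in> \<Gamma> U"
      by (rule differential_section[OF U])
    then show "X \<in> \<Gamma> U"
      by (rule section_cong[OF U]) (use openin_subset[OF U] in \<open>auto intro: differential_ident[OF M]\<close>)
  next
    fix X assume X: "X \<in> \<Gamma> U"
    have "smooth_on (chart_map c ` (chart_dom c \<inter> U)) ((\<lambda>y. vec_in M c y (X y)) \<circ> chart_inv c)"
      if c: "c \<in> atlas M" for c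
    proof -
      have "chart_dom c \<inter> U \<inter> (\<lambda>x. x) -` chart_dom c = chart_dom c \<inter> U"
        by auto
      then show ?thesis
        using sectionD[OF X c c] by simp
    qed
    then show "X \<in> \<XX> U"
      by (simp add: vector_fields_def)
  qed
qed

section \<open>Covariant derivatives and tensoriality\<close>

lemma dir_deriv_smooth:
  assumes M: "smooth_manifold M" and U: "openin (mtop M) U"
    and f: "smooth_fun M U f" and X: "X \<in> vector_fields M U"
  shows "smooth_fun M U (\<lambda>y. dir_deriv M f y (X y))"
  unfolding smooth_fun_def
proof
  fix c assume c: "c \<in> atlas M"
  let ?S = "chart_map c ` (chart_dom c \<inter> U)"
  have S: "open ?S"
    by (rule open_chart_image[OF M c openin_Int[OF chart_dom_open[OF M c] U]]) blast
  have "smooth_on ?S (\<lambda>z. frechet_derivative (f \<circ> chart_inv c) (at z)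
      (((\<lambda>y. vec_in M c y (X y)) \<circ> chart_inv c) z))"
    by (rule smooth_on_derivative_apply[OF S])
      (use f X c in \<open>simp_all add: smooth_fun_def vector_fields_def o_def\<close>)
  then show "smooth_on ?S ((\<lambda>y. dir_deriv M f y (X y)) \<circ> chart_inv c)"
    by (rule smooth_on_cong[OF S, rotated]) (use dir_deriv_in_chart[OF M U f c] M c in auto)
qed

context smooth_setting
begin

lemma open_in_preimage_chart:
  assumes "open_in U" "x \<in> U"
  shows "open_in (U \<inter> \<phi> -` chart_dom (chart_at N (\<phi> x)))"
    and "x \<in> U \<inter> \<phi> -` chart_dom (chart_at N (\<phi> x))"
    and "\<phi> x \<in> topspace (mtop N)" "x \<in> topspace (mtop M)"
proof -
  show x: "x \<in> topspace (mtop M)"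
    using assms openin_subset by blast
  then show z: "\<phi> x \<in> topspace (mtop N)"
    by (rule smooth_map_topspace[OF \<phi>])
  note d = chart_at_mem[OF N z]
  show "open_in (U \<inter> \<phi> -` chart_dom (chart_at N (\<phi> x)))"
    by (rule openin_preimage[OF \<phi> assms(1) chart_dom_open[OF N d(1)]])
  show "x \<in> U \<inter> \<phi> -` chart_dom (chart_at N (\<phi> x))"
    using d assms(2) by blast
qed

lemma extend_vec_section:
  assumes "open_in U" "z \<in> topspace (mtop N)" "\<phi> ` U \<subseteq> chart_dom (chart_at N z)"
  shows "(\<lambda>y. extend_vec N z v (\<phi> y)) \<in> \<Gamma> U"
  by (rule compose_section[OF assms(1) chart_dom_open[OF N chart_at_mem(1)[OF N assms(2)]]
        extend_vec_vector_field[OF assms(2)] assms(3)])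

text \<open>An operator on sections that is linear over the smooth functions is determined at \<open>x\<close> by the
  value of the section at \<open>x\<close>: expand the section in the frame \<open>extend_vec N (\<phi> x) b \<circ> \<phi>\<close>.\<close>

lemma tensorial_eq:
  fixes T :: "('a \<Rightarrow> 'f) \<Rightarrow> 'g::real_vector"
  assumes U: "open_in U" and x: "x \<in> U" and V: "V \<in> \<Gamma> U" and W: "W \<in> \<Gamma> U" and eq: "V x = W x"
    and add: "\<And>U' A B. open_in U' \<Longrightarrow> U' \<subseteq> U \<Longrightarrow> x \<in> U' \<Longrightarrow> A \<in> \<Gamma> U' \<Longrightarrow> B \<in> \<Gamma> U' \<Longrightarrow>
      T (\<lambda>y. A y + B y) = T A + T B"
    and scale: "\<And>U' f A. open_in U' \<Longrightarrow> U' \<subseteq> U \<Longrightarrow> x \<in> U' \<Longrightarrow> smooth_fun M U' f \<Longrightarrow> A \<in> \<Gamma> U' \<Longrightarrow>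
      T (\<lambda>y. f y *\<^sub>R A y) = f x *\<^sub>R T A"
    and cong: "\<And>U' A B. open_in U' \<Longrightarrow> U' \<subseteq> U \<Longrightarrow> x \<in> U' \<Longrightarrow> A \<in> \<Gamma> U' \<Longrightarrow> B \<in> \<Gamma> U' \<Longrightarrow>
      (\<And>y. y \<in> U' \<Longrightarrow> A y = B y) \<Longrightarrow> T A = T B"
  shows "T V = T W"
proof -
  define z where "z = \<phi> x"
  define d where "d = chart_at N z"
  \<comment> \<open>The coordinate frame exists only over the preimage of a chart domain. This is
    why the hypotheses on \<open>T\<close> are stated for all smaller neighbourhoods of
    \<open>x\<close>.\<close>
  define U' where "U' = U \<inter> \<phi> -` chart_dom d"
  have U': "open_in U'" "x \<in> U'" "U' \<subseteq> U" and z: "z \<in> topspace (mtop N)"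
    using open_in_preimage_chart[OF U x] by (auto simp: U'_def z_def d_def)
  have d: "d \<in> atlas N"
    using chart_at_mem[OF N z] by (simp add: d_def)
  have sub: "\<phi> ` U' \<subseteq> chart_dom d"
    by (auto simp: U'_def)
  note loc = U'(1,3,2)
  have zero: "T (\<lambda>y. 0) = 0"
    using scale[OF loc smooth_fun_const section_zero[OF U'(1)], of 0] by simp
  have sum: "T (\<lambda>y. \<Sum>b\<in>B. F b y) = (\<Sum>b\<in>B. T (F b))" if "\<And>b. b \<in> B \<Longrightarrow> F b \<in> \<Gamma> U'" for F and B :: "'f set"
    using that
    by (induction B rule: infinite_finite_induct)
      (simp_all add: zero add[OF loc] section_sum[OF U'(1)])
  have "T A = (\<Sum>b\<in>Basis. (vec_in N d z (A x) \<bullet> b) *\<^sub>R T (\<lambda>y. extend_vec N z b (\<phi> y)))" if A: "A \<in> \<Gamma> U" for A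
  proof -
    have A': "A \<in> \<Gamma> U'"
      using section_subset[OF A U'(3)] .
    note coef = section_coefficient_smooth[OF d sub U'(1) A']
    note frame = extend_vec_section[OF U'(1) z sub[unfolded d_def]]
    note summand = section_scale[OF U'(1) coef frame]
    have "T A = T (\<lambda>y. \<Sum>b\<in>Basis. (vec_in N d (\<phi> y) (A y) \<bullet> b) *\<^sub>R extend_vec N z b (\<phi> y))"
      using section_frame_expansion[OF z] sub
      by (intro cong[OF loc A' section_sum[OF U'(1) summand]]) (auto simp: d_def)
    also have "\<dots> = (\<Sum>b\<in>Basis. T (\<lambda>y. (vec_in N d (\<phi> y) (A y) \<bullet> b) *\<^sub>R extend_vec N z b (\<phi> y)))"
      by (rule sum[OF summand])
    also have "\<dots> = (\<Sum>b\<in>Basis. (vec_in N d z (A x) \<bullet> b) *\<^sub>R T (\<lambda>y. extend_vec N z b (\<phi> y)))"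
      unfolding scale[OF loc coef frame] by (simp add: z_def)
    finally show ?thesis .
  qed
  then show ?thesis
    using V W eq by simp
qed

text \<open>The coefficients of a smooth section in the coordinate frame are smooth, so a fibrewise
  linear family preserves smoothness once it does so on the frame. Multilinear expressions are
  treated one argument at a time.\<close>

lemma pointwise_linear_section:
  assumes U: "open_in U" and L: "\<And>y. y \<in> U \<Longrightarrow> linear (L y)"
    and z: "z \<in> topspace (mtop N)" and sub: "\<phi> ` U \<subseteq> chart_dom (chart_at N z)"
    and frame: "\<And>b. b \<in> Basis \<Longrightarrow> (\<lambda>y. L y (extend_vec N z b (\<phi> y))) \<in> \<Gamma> U" and V: "V \<in> \<Gamma> U"
  shows "(\<lambda>y. L y (V y)) \<in> \<Gamma> U"
proof (rule section_cong[OF U])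
  let ?d = "chart_at N z"
  note coef = section_coefficient_smooth[OF chart_at_mem(1)[OF N z] sub U V]
  show "(\<lambda>y. \<Sum>b\<in>Basis. (vec_in N ?d (\<phi> y) (V y) \<bullet> b) *\<^sub>R L y (extend_vec N z b (\<phi> y))) \<in> \<Gamma> U"
    by (rule section_sum[OF U section_scale[OF U coef frame]])
  show "(\<Sum>b\<in>Basis. (vec_in N ?d (\<phi> y) (V y) \<bullet> b) *\<^sub>R L y (extend_vec N z b (\<phi> y))) = L y (V y)"
    if y: "y \<in> U" for y
  proof -
    have "\<phi> y \<in> chart_dom ?d"
      using y sub by blast
    from section_frame_expansion[OF z this, of "V y"]
    have "L y (V y) = L y (\<Sum>b\<in>Basis. (vec_in N ?d (\<phi> y) (V y) \<bullet> b) *\<^sub>R extend_vec N z b (\<phi> y))"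
      by simp
    then show ?thesis
      by (simp add: linear_sum[OF L[OF y]] linear_scale[OF L[OF y]])
  qed
qed

end

locale covariant_derivative = smooth_setting M N \<phi>
  for M :: "('a, 'e::euclidean_space, 'y) manifold_scheme"
    and N :: "('b, 'f::euclidean_space, 'z) manifold_scheme"
    and \<phi> :: "'a \<Rightarrow> 'b" +
  fixes D :: "('a \<Rightarrow> 'f) \<Rightarrow> 'a \<Rightarrow> 'e \<Rightarrow> 'f"
  assumes D: "linear_connection M (sections_along M N \<phi>) D"
begin

lemmas D_rules = D[unfolded linear_connection_def, THEN spec, THEN mp, THEN bspec]

lemma D_linear: "open_in U \<Longrightarrow> V \<in> \<Gamma> U \<Longrightarrow> x \<in> U \<Longrightarrow> linear (D V x)"
  by (drule (1) D_rules) (elim conjE, erule (1) bspec)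

lemma D_section: "open_in U \<Longrightarrow> V \<in> \<Gamma> U \<Longrightarrow> X \<in> \<XX> U \<Longrightarrow> (\<lambda>y. D V y (X y)) \<in> \<Gamma> U"
  by (drule (1) D_rules) (elim conjE, erule (1) bspec)

lemma D_add:
  assumes "open_in U" "V \<in> \<Gamma> U" "W \<in> \<Gamma> U" "x \<in> U"
  shows "D (\<lambda>y. V y + W y) x v = D V x v + D W x v"
  using D_rules[OF assms(1,2), THEN conjunct2, THEN conjunct2, THEN conjunct1, THEN bspec, OF assms(3),
      THEN bspec, OF assms(4)] by (rule spec)

lemma D_scale:
  assumes "open_in U" "smooth_fun M U f" "V \<in> \<Gamma> U" "x \<in> U"
  shows "D (\<lambda>y. f y *\<^sub>R V y) x v = dir_deriv M f x v *\<^sub>R V x + f x *\<^sub>R D V x v"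
  using D_rules[OF assms(1,3), THEN conjunct2, THEN conjunct2, THEN conjunct2, THEN conjunct1, THEN spec,
      THEN mp, OF assms(2), THEN bspec, OF assms(4)] by (rule spec)

lemma D_cong:
  assumes "open_in U" "V \<in> \<Gamma> U" "x \<in> U" "\<And>y. y \<in> U \<Longrightarrow> W y = V y"
  shows "D W x = D V x"
  using D_rules[OF assms(1,2), THEN conjunct2, THEN conjunct2, THEN conjunct2, THEN conjunct2, THEN spec,
      THEN mp, of W] assms(3,4) by simp

lemma D_const_scale: "open_in U \<Longrightarrow> V \<in> \<Gamma> U \<Longrightarrow> x \<in> U \<Longrightarrow> D (\<lambda>y. r *\<^sub>R V y) x v = r *\<^sub>R D V x v"
  using D_scale[OF _ smooth_fun_const, of U V x r v] by (simp add: dir_deriv_const)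

lemma D_diff:
  assumes "open_in U" "V \<in> \<Gamma> U" "W \<in> \<Gamma> U" "x \<in> U"
  shows "D (\<lambda>y. V y - W y) x v = D V x v - D W x v"
  using D_add[OF assms(1,2) section_const_scale[OF assms(1,3), of "-1"] assms(4), of v]
    D_const_scale[OF assms(1,3,4), of "-1" v] by simp

lemma D_zero: "open_in U \<Longrightarrow> x \<in> U \<Longrightarrow> D (\<lambda>y. 0) x v = 0"
  using D_const_scale[OF _ section_zero, of U x 0 v] by simp

lemma D_sum:
  assumes U: "open_in U" and "\<And>b. b \<in> B \<Longrightarrow> smooth_fun M U (f b)" "\<And>b. b \<in> B \<Longrightarrow> V b \<in> \<Gamma> U" and x: "x \<in> U"
  shows "D (\<lambda>y. \<Sum>b\<in>B. f b y *\<^sub>R V b y) x v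
    = (\<Sum>b\<in>B. dir_deriv M (f b) x v *\<^sub>R V b x + f b x *\<^sub>R D (V b) x v)"
  using assms(2,3)
proof (induction B rule: infinite_finite_induct)
  case (insert a B)
  have "D (\<lambda>y. f a y *\<^sub>R V a y + (\<Sum>b\<in>B. f b y *\<^sub>R V b y)) x v
      = D (\<lambda>y. f a y *\<^sub>R V a y) x v + D (\<lambda>y. \<Sum>b\<in>B. f b y *\<^sub>R V b y) x v"
    using insert.prems by (intro D_add[OF U _ _ x] section_scale[OF U] section_sum[OF U]) auto
  then show ?case
    using insert D_scale[OF U _ _ x, of "f a" "V a" v] by simp
qed (simp_all add: D_zero[OF U x])

text \<open>The difference is the covariant derivative of the bundle endomorphism \<open>L\<close>,
  applied to \<open>V\<close>. When \<open>V\<close> is multiplied by a function, the two terms with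
  the derivative of that function cancel, so only the value of \<open>V\<close> at \<open>x\<close>
  counts and \<open>V\<close> may be traded for a frame section.\<close>

lemma covariant_derivative_of_endomorphism_tensorial:
  assumes U: "open_in U" and L: "\<And>y. y \<in> U \<Longrightarrow> linear (L y)"
    and pres: "\<And>U' A. open_in U' \<Longrightarrow> U' \<subseteq> U \<Longrightarrow> A \<in> \<Gamma> U' \<Longrightarrow> (\<lambda>y. L y (A y)) \<in> \<Gamma> U'"
    and x: "x \<in> U" and V: "V \<in> \<Gamma> U" and W: "W \<in> \<Gamma> U" and eq: "V x = W x"
  shows "D (\<lambda>y. L y (V y)) x v - L x (D V x v) = D (\<lambda>y. L y (W y)) x v - L x (D W x v)"
proof (rule tensorial_eq[OF U x V W eq, where T = "\<lambda>V. D (\<lambda>y. L y (V y)) x v - L x (D V x v)"])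
  fix U' A B assume U': "open_in U'" "U' \<subseteq> U" and x': "x \<in> U'" and A: "A \<in> \<Gamma> U'" and B: "B \<in> \<Gamma> U'"
  note LA = pres[OF U' A] and LB = pres[OF U' B]
  have "D (\<lambda>y. L y (A y + B y)) x = D (\<lambda>y. L y (A y) + L y (B y)) x"
    by (rule D_cong[OF U'(1) section_add[OF U'(1) LA LB] x']) (use L U'(2) in \<open>auto simp: linear_add\<close>)
  then show "D (\<lambda>y. L y (A y + B y)) x v - L x (D (\<lambda>y. A y + B y) x v)
      = D (\<lambda>y. L y (A y)) x v - L x (D A x v) + (D (\<lambda>y. L y (B y)) x v - L x (D B x v))"
    using D_add[OF U'(1) LA LB x'] D_add[OF U'(1) A B x'] by (simp add: linear_add[OF L[OF x]])
  show "D (\<lambda>y. L y (A y)) x v - L x (D A x v) = D (\<lambda>y. L y (B y)) x v - L x (D B x v)"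
    if "\<And>y. y \<in> U' \<Longrightarrow> A y = B y"
  proof -
    have "D (\<lambda>y. L y (A y)) x = D (\<lambda>y. L y (B y)) x"
      by (rule D_cong[OF U'(1) LB x']) (simp add: that)
    moreover have "D A x = D B x"
      by (rule D_cong[OF U'(1) B x']) (simp add: that)
    ultimately show ?thesis by simp
  qed
next
  fix U' f A assume U': "open_in U'" "U' \<subseteq> U" and x': "x \<in> U'" and f: "smooth_fun M U' f" and A: "A \<in> \<Gamma> U'"
  note LA = pres[OF U' A]
  have "D (\<lambda>y. L y (f y *\<^sub>R A y)) x = D (\<lambda>y. f y *\<^sub>R L y (A y)) x"
    by (rule D_cong[OF U'(1) section_scale[OF U'(1) f LA] x']) (use L U'(2) in \<open>auto simp: linear_scale\<close>)
  then show "D (\<lambda>y. L y (f y *\<^sub>R A y)) x v - L x (D (\<lambda>y. f y *\<^sub>R A y) x v)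
      = f x *\<^sub>R (D (\<lambda>y. L y (A y)) x v - L x (D A x v))"
    using D_scale[OF U'(1) f LA x'] D_scale[OF U'(1) f A x']
    by (simp add: linear_add[OF L[OF x]] linear_scale[OF L[OF x]] scaleR_diff_right)
qed

text \<open>The same expression as \<open>curv\<close>, but for a section \<open>V\<close> along
  \<phi> rather than a vector field, so that it also covers the curvature of the pull-back
  connection.\<close>

definition "curv_op X Y V x = D (\<lambda>y. D V y (Y y)) x (X x) - D (\<lambda>y. D V y (X y)) x (Y x)
    - D V x (lie_bracket M X Y x)"

lemma curv_op_cong:
  assumes U: "open_in U" and X: "X \<in> \<XX> U" and Y: "Y \<in> \<XX> U" and B: "B \<in> \<Gamma> U" and x: "x \<in> U"
    and eq: "\<And>y. y \<in> U \<Longrightarrow> A y = B y"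
  shows "curv_op X Y A x = curv_op X Y B x"
proof -
  have D_eq: "D A y = D B y" if "y \<in> U" for y
    by (rule D_cong[OF U B that]) (simp add: eq)
  have "D (\<lambda>y. D A y (Z y)) x = D (\<lambda>y. D B y (Z y)) x" if "Z \<in> \<XX> U" for Z
    by (rule D_cong[OF U D_section[OF U B that] x]) (simp add: D_eq)
  then show ?thesis
    using X Y by (simp add: curv_op_def D_eq[OF x])
qed

lemma curv_op_add:
  assumes U: "open_in U" and X: "X \<in> \<XX> U" and Y: "Y \<in> \<XX> U" and A: "A \<in> \<Gamma> U" and B: "B \<in> \<Gamma> U" and x: "x \<in> U"
  shows "curv_op X Y (\<lambda>y. A y + B y) x = curv_op X Y A x + curv_op X Y B x"
proof -
  have "D (\<lambda>y. D (\<lambda>y. A y + B y) y (Z y)) x v = D (\<lambda>y. D A y (Z y)) x v + D (\<lambda>y. D B y (Z y)) x v"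
    if Z: "Z \<in> \<XX> U" for Z v
  proof -
    note A' = D_section[OF U A Z] and B' = D_section[OF U B Z]
    have "D (\<lambda>y. D (\<lambda>y. A y + B y) y (Z y)) x = D (\<lambda>y. D A y (Z y) + D B y (Z y)) x"
      by (rule D_cong[OF U section_add[OF U A' B'] x]) (simp add: D_add[OF U A B])
    then show ?thesis
      by (simp add: D_add[OF U A' B' x])
  qed
  then show ?thesis
    using X Y by (simp add: curv_op_def D_add[OF U A B x])
qed

text \<open>The products of first derivatives of \<open>f\<close> and \<open>A\<close> are symmetric
  in \<open>X\<close> and \<open>Y\<close> and cancel. The second derivatives of \<open>f\<close>
  leave its derivative along the bracket, which the bracket term of \<open>curv_op\<close>
  removes.\<close>

lemma curv_op_scale:
  assumes U: "open_in U" and X: "X \<in> \<XX> U" and Y: "Y \<in> \<XX> U" and f: "smooth_fun M U f" and A: "A \<in> \<Gamma> U"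
    and x: "x \<in> U"
  shows "curv_op X Y (\<lambda>y. f y *\<^sub>R A y) x = f x *\<^sub>R curv_op X Y A x"
proof -
  have second: "D (\<lambda>y. D (\<lambda>y. f y *\<^sub>R A y) y (Z y)) x v
      = dir_deriv M (\<lambda>y. dir_deriv M f y (Z y)) x v *\<^sub>R A x + dir_deriv M f x (Z x) *\<^sub>R D A x v
        + dir_deriv M f x v *\<^sub>R D A x (Z x) + f x *\<^sub>R D (\<lambda>y. D A y (Z y)) x v"
    if Z: "Z \<in> \<XX> U" for Z v
  proof -
    note A' = D_section[OF U A Z] and f' = dir_deriv_smooth[OF M U f Z]
    note s = section_scale[OF U f' A] section_scale[OF U f A']
    have "D (\<lambda>y. D (\<lambda>y. f y *\<^sub>R A y) y (Z y)) x
        = D (\<lambda>y. dir_deriv M f y (Z y) *\<^sub>R A y + f y *\<^sub>R D A y (Z y)) x"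
      by (rule D_cong[OF U section_add[OF U s] x]) (simp add: D_scale[OF U f A])
    then show ?thesis
      by (simp add: D_add[OF U s x] D_scale[OF U f' A x] D_scale[OF U f A' x])
  qed
  show ?thesis
    unfolding curv_op_def second[OF X] second[OF Y] D_scale[OF U f A x]
      dir_deriv_commutator[OF M U f X Y x, symmetric]
    by (simp add: algebra_simps)
qed

lemma curv_op_tensorial:
  assumes U: "open_in U" and X: "X \<in> \<XX> U" and Y: "Y \<in> \<XX> U" and V: "V \<in> \<Gamma> U" and W: "W \<in> \<Gamma> U"
    and x: "x \<in> U" and eq: "V x = W x"
  shows "curv_op X Y V x = curv_op X Y W x"
proof (rule tensorial_eq[OF U x V W eq, where T = "\<lambda>V. curv_op X Y V x"])
  fix U' A assume U': "open_in U'" "U' \<subseteq> U" and x': "x \<in> U'" and A: "A \<in> \<Gamma> U'"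
  note X' = vector_fields_subset[OF X U'(2)] and Y' = vector_fields_subset[OF Y U'(2)]
  show "curv_op X Y (\<lambda>y. A y + B y) x = curv_op X Y A x + curv_op X Y B x" if "B \<in> \<Gamma> U'" for B
    by (rule curv_op_add[OF U'(1) X' Y' A that x'])
  show "curv_op X Y (\<lambda>y. f y *\<^sub>R A y) x = f x *\<^sub>R curv_op X Y A x" if "smooth_fun M U' f" for f
    by (rule curv_op_scale[OF U'(1) X' Y' that A x'])
  show "curv_op X Y A x = curv_op X Y B x" if "B \<in> \<Gamma> U'" "\<And>y. y \<in> U' \<Longrightarrow> A y = B y" for B
    by (rule curv_op_cong[OF U'(1) X' Y' that(1) x' that(2)])
qed

end

section \<open>Torsion-free connections\<close>

lemma linear_connection_cong:
  assumes eq: "\<And>U. openin (mtop M) U \<Longrightarrow> \<Gamma> U = \<Gamma>' U" and D: "linear_connection M \<Gamma> D"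
  shows "linear_connection M \<Gamma>' D"
  unfolding linear_connection_def
proof (rule allI, rule impI)
  fix U assume U: "openin (mtop M) U"
  from D[unfolded linear_connection_def, THEN spec, THEN mp, OF U]
  show "\<forall>V\<in>\<Gamma>' U.
       (\<forall>x\<in>U. linear (D V x)) \<and>
       (\<forall>X\<in>vector_fields M U. (\<lambda>x. D V x (X x)) \<in> \<Gamma>' U) \<and>
       (\<forall>W\<in>\<Gamma>' U. \<forall>x\<in>U. \<forall>v. D (\<lambda>y. V y + W y) x v = D V x v + D W x v) \<and>
       (\<forall>f. smooth_fun M U f \<longrightarrow> (\<forall>x\<in>U. \<forall>v.
          D (\<lambda>y. f y *\<^sub>R V y) x v = dir_deriv M f x v *\<^sub>R V x + f x *\<^sub>R D V x v)) \<and>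
       (\<forall>W. (\<forall>y\<in>U. W y = V y) \<longrightarrow> (\<forall>x\<in>U. D W x = D V x))"
    unfolding eq[OF U] .
qed

lemma lie_bracket_skew: "lie_bracket M Y X x = - lie_bracket M X Y x"
  by (simp add: lie_bracket_def Let_def)

text \<open>In the chart at \<open>z\<close> both fields have constant coordinates, so each
  derivative in the coordinate formula vanishes.\<close>

lemma lie_bracket_extend_vec:
  assumes M: "smooth_manifold M" and z: "z \<in> topspace (mtop M)"
  shows "lie_bracket M (extend_vec M z u) (extend_vec M z v) z = 0"
proof -
  let ?c = "chart_at M z"
  note c = chart_at_mem[OF M z]
  have "frechet_derivative (\<lambda>_. w) (at (chart_map ?c z))
      = frechet_derivative ((\<lambda>y. vec_in M ?c y (extend_vec M z w y)) \<circ> chart_inv ?c) (at (chart_map ?c z))" for w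
  proof (rule frechet_derivative_transform_within_open)
    show "open (chart_map ?c ` chart_dom ?c)"
      using open_chart_image[OF M c(1) chart_dom_open[OF M c(1)]] by simp
    show "w = ((\<lambda>y. vec_in M ?c y (extend_vec M z w y)) \<circ> chart_inv ?c) p" if "p \<in> chart_map ?c ` chart_dom ?c" for p
      using that vec_in_extend_vec[OF M z c(1)] M c by auto
  qed (use c in auto)
  from fun_cong[OF this] show ?thesis
    by (simp add: lie_bracket_def Let_def)
qed

text \<open>Shared by both manifolds: torsion freeness lets brackets be traded for covariant
  derivatives. Read as a connection along the identity, \<open>D\<close> inherits all rules for
  sections along a map.\<close>

locale torsion_free_connection =
  fixes M :: "('a, 'e::euclidean_space, 'y) manifold_scheme"
    and D :: "('a \<Rightarrow> 'e) \<Rightarrow> 'a \<Rightarrow> 'e \<Rightarrow> 'e"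
  assumes smooth_manifold: "smooth_manifold M"
    and linear_connection: "linear_connection M (vector_fields M) D"
    and torsion_free: "openin (mtop M) U \<Longrightarrow> X \<in> vector_fields M U \<Longrightarrow> Y \<in> vector_fields M U \<Longrightarrow> x \<in> U \<Longrightarrow>
      D Y x (X x) - D X x (Y x) = lie_bracket M X Y x"
begin

sublocale covariant_derivative M M "\<lambda>x. x" D
proof unfold_locales
  show "linear_connection M (sections_along M M (\<lambda>x. x)) D"
    by (rule linear_connection_cong[OF vector_fields_eq_sections[OF smooth_manifold] linear_connection])
qed (use smooth_manifold smooth_map_ident in auto)

lemma sections_eq: "open_in U \<Longrightarrow> \<Gamma> U = \<XX> U"
  using vector_fields_eq_sections[OF M] by simp

text \<open>Smoothness is inherited from the two covariant derivatives whose difference is the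
  bracket, which avoids a computation in charts.\<close>

lemma lie_bracket_vector_field:
  assumes U: "open_in U" and X: "X \<in> \<XX> U" and Y: "Y \<in> \<XX> U"
  shows "lie_bracket M X Y \<in> \<XX> U"
proof -
  note s = sections_eq[OF U]
  have "(\<lambda>y. D Y y (X y) - D X y (Y y)) \<in> \<Gamma> U"
    using X Y by (intro section_diff[OF U] D_section[OF U]) (simp_all add: s)
  then have "lie_bracket M X Y \<in> \<Gamma> U"
    by (rule section_cong[OF U]) (simp add: torsion_free[OF U X Y])
  then show ?thesis
    by (simp add: s)
qed

lemma curv_eq_curv_op: "curv M D X Y Z = curv_op X Y Z"
  by (simp add: curv_def curv_op_def fun_eq_iff)

lemma curv_vector_field:
  assumes U: "open_in U" and X: "X \<in> \<XX> U" and Y: "Y \<in> \<XX> U" and Z: "Z \<in> \<XX> U"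
  shows "curv M D X Y Z \<in> \<XX> U"
proof -
  note s = sections_eq[OF U]
  have "(\<lambda>x. D (\<lambda>y. D Z y (Y y)) x (X x) - D (\<lambda>y. D Z y (X y)) x (Y x) - D Z x (lie_bracket M X Y x)) \<in> \<Gamma> U"
    using X Y Z lie_bracket_vector_field[OF U X Y]
    by (intro section_diff[OF U] D_section[OF U]) (simp_all add: s)
  then show ?thesis
    unfolding curv_def s .
qed

lemma curv_skew:
  assumes U: "open_in U" and X: "X \<in> \<XX> U" and Y: "Y \<in> \<XX> U" and Z: "Z \<in> \<XX> U" and x: "x \<in> U"
  shows "curv M D Y X Z x = - curv M D X Y Z x"
  using linear_neg[OF D_linear[OF U _ x, of Z]] Z
  by (simp add: curv_def lie_bracket_skew[of M Y X] sections_eq[OF U])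

text \<open>Real coefficients suffice here: that the curvature depends on its arguments only through
  their values at the point comes from \<open>pullback_curvature\<close>, and the two together give
  linearity of \<open>curv_at\<close>.\<close>

lemma curv_linear_left:
  assumes U: "open_in U" and X: "X \<in> \<XX> U" and X': "X' \<in> \<XX> U" and Y: "Y \<in> \<XX> U" and Z: "Z \<in> \<XX> U" and x: "x \<in> U"
  shows "curv M D (\<lambda>y. r *\<^sub>R X y + X' y) Y Z x = r *\<^sub>R curv M D X Y Z x + curv M D X' Y Z x"
proof -
  note s = sections_eq[OF U]
  have rX: "(\<lambda>y. r *\<^sub>R X y) \<in> \<XX> U"
    using section_const_scale[OF U, of X] X by (simp add: s)
  have XX': "(\<lambda>y. r *\<^sub>R X y + X' y) \<in> \<XX> U"
    using section_add[OF U, of "\<lambda>y. r *\<^sub>R X y" X'] rX X' by (simp add: s)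
  have DZ: "linear (D Z y)" if "y \<in> U" for y
    using D_linear[OF U _ that, of Z] Z by (simp add: s)
  have DZX: "(\<lambda>y. D Z y (W y)) \<in> \<Gamma> U" if "W \<in> \<XX> U" for W
    using D_section[OF U, of Z] Z that by (simp add: s)
  have "D (\<lambda>y. D Z y (r *\<^sub>R X y + X' y)) x = D (\<lambda>y. r *\<^sub>R D Z y (X y) + D Z y (X' y)) x"
    using section_add[OF U section_const_scale[OF U DZX[OF X]] DZX[OF X']]
    by (rule D_cong[OF U _ x]) (simp add: linear_add[OF DZ] linear_scale[OF DZ])
  then have 1: "D (\<lambda>y. D Z y (r *\<^sub>R X y + X' y)) x v
      = r *\<^sub>R D (\<lambda>y. D Z y (X y)) x v + D (\<lambda>y. D Z y (X' y)) x v" for v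
    using D_add[OF U section_const_scale[OF U DZX[OF X]] DZX[OF X'] x] D_const_scale[OF U DZX[OF X] x]
    by simp
  have 2: "linear (D W x)" if "W \<in> \<XX> U" for W
    using D_linear[OF U _ x, of W] that by (simp add: s)
  have 3: "D (\<lambda>y. r *\<^sub>R X y + X' y) x v = r *\<^sub>R D X x v + D X' x v" for v
    using D_add[OF U, of "\<lambda>y. r *\<^sub>R X y" X' x v] D_const_scale[OF U, of X x r v] rX X X' x by (simp add: s)
  have "lie_bracket M (\<lambda>y. r *\<^sub>R X y + X' y) Y x = r *\<^sub>R lie_bracket M X Y x + lie_bracket M X' Y x"
    unfolding torsion_free[OF U XX' Y x, symmetric] torsion_free[OF U X Y x, symmetric] torsion_free[OF U X' Y x, symmetric] 3
    by (simp add: linear_add[OF 2[OF Y]] linear_scale[OF 2[OF Y]] scaleR_diff_right)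
  moreover have "(\<lambda>y. D Z y (Y y)) \<in> \<XX> U"
    using DZX[OF Y] by (simp add: s)
  note 4 = 2[OF this]
  ultimately show ?thesis
    unfolding curv_def 1
    by (simp add: linear_add[OF 4] linear_scale[OF 4] linear_add[OF 2[OF Z]] linear_scale[OF 2[OF Z]]
        algebra_simps)
qed

lemma curv_linear_right:
  assumes U: "open_in U" and X: "X \<in> \<XX> U" and Y: "Y \<in> \<XX> U" and Z: "Z \<in> \<XX> U" and Z': "Z' \<in> \<XX> U" and x: "x \<in> U"
  shows "curv M D X Y (\<lambda>y. r *\<^sub>R Z y + Z' y) x = r *\<^sub>R curv M D X Y Z x + curv M D X Y Z' x"
proof -
  note s = sections_eq[OF U]
  have Zs: "Z \<in> \<Gamma> U" "Z' \<in> \<Gamma> U"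
    using Z Z' by (simp_all add: s)
  show ?thesis
    unfolding curv_eq_curv_op curv_op_add[OF U X Y section_const_scale[OF U Zs(1)] Zs(2) x]
      curv_op_scale[OF U X Y smooth_fun_const Zs(1) x] ..
qed

end

section \<open>The pull-back connection\<close>

locale pullback_setting = smooth_setting M N \<phi> + NN: torsion_free_connection N DN
  for M :: "('a, 'e::euclidean_space, 'y) manifold_scheme"
    and N :: "('b, 'f::euclidean_space, 'z) manifold_scheme"
    and \<phi> :: "'a \<Rightarrow> 'b"
    and DN :: "('b \<Rightarrow> 'f) \<Rightarrow> 'b \<Rightarrow> 'f \<Rightarrow> 'f" +
  fixes Db :: "('a \<Rightarrow> 'f) \<Rightarrow> 'a \<Rightarrow> 'e \<Rightarrow> 'f"
  assumes pullback: "pullback_connection M N \<phi> DN Db"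
begin

sublocale covariant_derivative M N \<phi> Db
  using pullback by unfold_locales (simp add: pullback_connection_def)

lemma Db_comp:
  assumes "openin (mtop N) W" "E \<in> vector_fields N W" "x \<in> topspace (mtop M)" "\<phi> x \<in> W"
  shows "Db (\<lambda>y. E (\<phi> y)) x v = DN E (\<phi> x) (d\<phi> x v)"
  using pullback assms unfolding pullback_connection_def by meson

lemma pullback_setting_ident: "pullback_setting N N (\<lambda>x. x) DN DN"
proof unfold_locales
  show "pullback_connection N N (\<lambda>x. x) DN DN"
    unfolding pullback_connection_def by (simp add: NN.D differential_ident[OF N])
qed

lemma d\<phi>_linear: "x \<in> topspace (mtop M) \<Longrightarrow> linear (d\<phi> x)"
  by (rule differential_linear[OF M N \<phi>])

text \<open>The product rule for \<open>d\<phi> Y\<close> in the pulled-back coordinate frame, where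
  the coefficients are the derivatives along \<open>Y\<close> of the coordinates of \<phi>. Their
  own derivatives form the sum; the derivatives of the frame form the Christoffel term at the
  end.\<close>

lemma Db_differential_expansion:
  assumes U: "open_in U" and x: "x \<in> U" and sub: "\<phi> ` U \<subseteq> chart_dom (chart_at N (\<phi> x))" and Y: "Y \<in> \<XX> U"
  shows "Db (\<lambda>y. d\<phi> y (Y y)) x v
    = (\<Sum>b\<in>Basis. dir_deriv M (\<lambda>y. dir_deriv M (\<lambda>y. chart_map (chart_at N (\<phi> x)) (\<phi> y) \<bullet> b) y (Y y)) x v *\<^sub>R b)
      + DN (extend_vec N (\<phi> x) (d\<phi> x (Y x))) (\<phi> x) (d\<phi> x v)"
proof -
  define z where "z = \<phi> x"
  define d where "d = chart_at N z"
  have xM: "x \<in> topspace (mtop M)" and zN: "z \<in> topspace (mtop N)"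
    using open_in_preimage_chart[OF U x] by (simp_all add: z_def)
  have d: "d \<in> atlas N" "z \<in> chart_dom d"
    using chart_at_mem[OF N zN] by (simp_all add: d_def)
  have subd: "\<phi> ` U \<subseteq> chart_dom d"
    using sub by (simp add: d_def z_def)
  note W = chart_dom_open[OF N d(1)]
  let ?E = "\<lambda>b. extend_vec N z b"
  have E: "?E b \<in> vector_fields N (chart_dom d)" for b
    using extend_vec_vector_field[OF zN] by (simp add: d_def)
  let ?k = "\<lambda>b y. dir_deriv M (\<lambda>y. chart_map d (\<phi> y) \<bullet> b) y (Y y)"
  have k: "?k b y = vec_in N d (\<phi> y) (d\<phi> y (Y y)) \<bullet> b" if "y \<in> U" for b y
    using that subd openin_subset[OF U] by (intro chart_coordinate_dir_deriv d) auto
  have k_smooth: "smooth_fun M U (?k b)" for b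
    by (rule dir_deriv_smooth[OF M U chart_coordinate_smooth[OF d(1) subd U] Y])
  have frame: "(\<lambda>y. ?E b (\<phi> y)) \<in> \<Gamma> U" for b
    by (rule extend_vec_section[OF U zN]) (use subd in \<open>simp add: d_def\<close>)
  have kx: "?k b x = d\<phi> x (Y x) \<bullet> b" for b
    using k[OF x] N zN by (simp add: z_def[symmetric]) (simp add: d_def)
  have "Db (\<lambda>y. d\<phi> y (Y y)) x = Db (\<lambda>y. \<Sum>b\<in>Basis. ?k b y *\<^sub>R ?E b (\<phi> y)) x"
  proof (rule D_cong[OF U section_sum[OF U section_scale[OF U k_smooth frame]] x])
    fix y assume y: "y \<in> U"
    then have "\<phi> y \<in> chart_dom (chart_at N z)"
      using subd by (auto simp: d_def)
    from section_frame_expansion[OF zN this, of "d\<phi> y (Y y)"]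
    show "d\<phi> y (Y y) = (\<Sum>b\<in>Basis. ?k b y *\<^sub>R ?E b (\<phi> y))"
      unfolding k[OF y] unfolding d_def .
  qed
  then have "Db (\<lambda>y. d\<phi> y (Y y)) x v
      = (\<Sum>b\<in>Basis. dir_deriv M (?k b) x v *\<^sub>R ?E b z + ?k b x *\<^sub>R DN (?E b) z (d\<phi> x v))"
    using D_sum[OF U k_smooth frame x, where B = Basis] Db_comp[OF W E xM] d(2)
    by (simp add: z_def)
  \<comment> \<open>\<open>extend_vec\<close> is linear in the vector, so the frame terms with
    coefficients frozen at \<open>x\<close> are the derivative of a single coordinate field.\<close>
  moreover have "DN (extend_vec N z (d\<phi> x (Y x))) z w = (\<Sum>b\<in>Basis. ?k b x *\<^sub>R DN (?E b) z w)" for w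
  proof -
    have E': "?E b \<in> NN.\<Gamma> (chart_dom d)" for b
      using E NN.sections_eq[OF W] by simp
    have "DN (extend_vec N z (d\<phi> x (Y x))) z = DN (\<lambda>y. \<Sum>b\<in>Basis. (d\<phi> x (Y x) \<bullet> b) *\<^sub>R ?E b y) z"
    proof (rule NN.D_cong[OF W NN.section_sum[OF W NN.section_const_scale[OF W E']] d(2)])
      show "extend_vec N z (d\<phi> x (Y x)) y = (\<Sum>b\<in>Basis. (d\<phi> x (Y x) \<bullet> b) *\<^sub>R ?E b y)"
        if "y \<in> chart_dom d" for y
        using linear_basis_expansion[OF extend_vec_linear[OF N zN]] that by (simp add: d_def)
    qed
    then show ?thesis
      using NN.D_sum[OF W smooth_fun_const E' d(2), where B = Basis] by (simp add: kx dir_deriv_const)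
  qed
  ultimately show ?thesis
    using N zN by (simp add: sum.distrib z_def[symmetric] d_def[symmetric])
qed

text \<open>The Christoffel terms agree because \<open>DN\<close> is torsion free and coordinate
  fields commute. The second derivatives of the coordinates of \<phi> differ by their derivative
  along the bracket, the component of \<open>d\<phi> x (lie_bracket M X Y x)\<close>.\<close>

lemma pullback_torsion_free:
  assumes U: "open_in U" and X: "X \<in> \<XX> U" and Y: "Y \<in> \<XX> U" and x: "x \<in> U"
  shows "Db (\<lambda>y. d\<phi> y (Y y)) x (X x) - Db (\<lambda>y. d\<phi> y (X y)) x (Y x) = d\<phi> x (lie_bracket M X Y x)"
proof -
  define z where "z = \<phi> x"
  define d where "d = chart_at N z"
  define U' where "U' = U \<inter> \<phi> -` chart_dom d"
  have U': "open_in U'" "x \<in> U'" "U' \<subseteq> U" and z: "z \<in> topspace (mtop N)" and xM: "x \<in> topspace (mtop M)"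
    using open_in_preimage_chart[OF U x] by (auto simp: U'_def z_def d_def)
  have sub: "\<phi> ` U' \<subseteq> chart_dom d"
    by (auto simp: U'_def)
  have d: "d \<in> atlas N" "z \<in> chart_dom d"
    using chart_at_mem[OF N z] by (simp_all add: d_def)
  note X' = vector_fields_subset[OF X U'(3)] and Y' = vector_fields_subset[OF Y U'(3)]
  note ex = Db_differential_expansion[OF U'(1,2) sub[unfolded d_def z_def]]
  note W = chart_dom_open[OF N d(1)]
  let ?u = "d\<phi> x (X x)" and ?v = "d\<phi> x (Y x)"
  have E: "extend_vec N z w \<in> vector_fields N (chart_dom d)" for w
    using extend_vec_vector_field[OF z] by (simp add: d_def)
  have flat: "DN (extend_vec N z ?v) z ?u = DN (extend_vec N z ?u) z ?v"
    using NN.torsion_free[OF W E E d(2), of ?v ?u] lie_bracket_extend_vec[OF N z] N z by simp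
  have bracket: "dir_deriv M (\<lambda>y. dir_deriv M (\<lambda>y. chart_map d (\<phi> y) \<bullet> b) y (Y y)) x (X x)
      - dir_deriv M (\<lambda>y. dir_deriv M (\<lambda>y. chart_map d (\<phi> y) \<bullet> b) y (X y)) x (Y x)
      = d\<phi> x (lie_bracket M X Y x) \<bullet> b" for b
    unfolding dir_deriv_commutator[OF M U'(1) chart_coordinate_smooth[OF d(1) sub U'(1)] X' Y' U'(2)]
    using chart_coordinate_dir_deriv[OF d(1) _ xM] d(2) N z by (simp add: z_def[symmetric]) (simp add: d_def)
  have "Db (\<lambda>y. d\<phi> y (Y y)) x (X x) - Db (\<lambda>y. d\<phi> y (X y)) x (Y x)
      = (\<Sum>b\<in>Basis. (d\<phi> x (lie_bracket M X Y x) \<bullet> b) *\<^sub>R b)"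
    unfolding ex[OF X'] ex[OF Y']
    by (simp add: z_def[symmetric] d_def[symmetric] flat bracket[symmetric] sum_subtractf scaleR_diff_left)
  then show ?thesis
    by (simp add: euclidean_representation)
qed

text \<open>By tensoriality \<open>V\<close> may be replaced by a coordinate field of
  \<open>N\<close> composed with \<phi>. Its second derivatives still involve derivatives of
  \<open>d\<phi> X\<close> and \<open>d\<phi> Y\<close>, which are not fields on \<open>N\<close>;
  by \<open>pullback_torsion_free\<close> these cancel against the bracket term, and the rest is an
  expression in \<open>DN\<close> on coordinate fields.\<close>

lemma pullback_curvature:
  assumes U: "open_in U" and X: "X \<in> \<XX> U" and Y: "Y \<in> \<XX> U" and V: "V \<in> \<Gamma> U" and x: "x \<in> U"
  shows "curv_op X Y V x = curv_at N DN (\<phi> x) (d\<phi> x (X x)) (d\<phi> x (Y x)) (V x)"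
proof -
  define z where "z = \<phi> x"
  define d where "d = chart_at N z"
  define U' where "U' = U \<inter> \<phi> -` chart_dom d"
  have U': "open_in U'" "x \<in> U'" "U' \<subseteq> U" and z: "z \<in> topspace (mtop N)" and xM: "x \<in> topspace (mtop M)"
    using open_in_preimage_chart[OF U x] by (auto simp: U'_def z_def d_def)
  have sub: "\<phi> ` U' \<subseteq> chart_dom d"
    by (auto simp: U'_def)
  have d: "d \<in> atlas N" "z \<in> chart_dom d"
    using chart_at_mem[OF N z] by (simp_all add: d_def)
  note X' = vector_fields_subset[OF X U'(3)] and Y' = vector_fields_subset[OF Y U'(3)]
  note V' = section_subset[OF V U'(3)]
  note W = chart_dom_open[OF N d(1)]
  let ?E = "extend_vec N z"
  have E: "?E w \<in> vector_fields N (chart_dom d)" for w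
    using extend_vec_vector_field[OF z] by (simp add: d_def)
  have E': "?E w \<in> NN.\<Gamma> (chart_dom d)" for w
    using E NN.sections_eq[OF W] by simp
  have frame: "(\<lambda>y. ?E w (\<phi> y)) \<in> \<Gamma> U''" if "open_in U''" "U'' \<subseteq> U'" for w U''
    by (rule extend_vec_section[OF that(1) z]) (use sub that(2) in \<open>auto simp: d_def\<close>)
  let ?F = "?E (V x)" and ?u = "d\<phi> x (X x)" and ?v = "d\<phi> x (Y x)"
  \<comment> \<open>The full covariant derivative of \<open>?F\<close>, viewed as an endomorphism of
    the pull-back bundle: differentiating \<open>?F\<close> composed with \<phi> along
    \<open>Z\<close> means applying \<open>?Q\<close> to \<open>d\<phi> Z\<close>.\<close>
  let ?Q = "\<lambda>y. DN ?F (\<phi> y)"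
  have Q_linear: "linear (?Q y)" if "y \<in> U'" for y
    using that sub by (intro NN.D_linear[OF W E']) auto
  have DE: "(\<lambda>y. DN (?E w) y (?E w' y)) \<in> vector_fields N (chart_dom d)" for w w'
    using NN.D_section[OF W E' E] NN.sections_eq[OF W] by simp
  have Q_section: "(\<lambda>y. ?Q y (A y)) \<in> \<Gamma> U''" if U'': "open_in U''" "U'' \<subseteq> U'" and A: "A \<in> \<Gamma> U''" for U'' A
  proof (rule pointwise_linear_section[OF U''(1) _ z _ _ A])
    show sub'': "\<phi> ` U'' \<subseteq> chart_dom (chart_at N z)"
      using sub U''(2) by (auto simp: d_def)
    show "(\<lambda>y. ?Q y (?E b (\<phi> y))) \<in> \<Gamma> U''" for b
      by (rule compose_section[OF U''(1) W DE]) (use sub'' in \<open>simp add: d_def\<close>)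
  qed (use Q_linear U''(2) in blast)
  have DbF: "Db (\<lambda>y. ?F (\<phi> y)) y w = ?Q y (d\<phi> y w)" if "y \<in> U'" for y w
    using that sub openin_subset[OF U'(1)] by (intro Db_comp[OF W E]) auto
  \<comment> \<open>Splits the derivative of \<open>?Q\<close> applied to \<open>d\<phi> Z\<close>
    into \<open>?Q\<close> on the derivative of \<open>d\<phi> Z\<close> and the derivative of
    \<open>?Q\<close> itself. The latter is tensorial, so there \<open>d\<phi> Z\<close> is replaced
    by the coordinate field with the same value at \<open>x\<close>.\<close>
  have second: "Db (\<lambda>y. Db (\<lambda>y. ?F (\<phi> y)) y (Z y)) x w
      = ?Q x (Db (\<lambda>y. d\<phi> y (Z y)) x w)
        + (DN (\<lambda>y. DN ?F y (?E (d\<phi> x (Z x)) y)) z (d\<phi> x w) - DN ?F z (DN (?E (d\<phi> x (Z x))) z (d\<phi> x w)))"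
    if Z: "Z \<in> \<XX> U'" for Z w
  proof -
    note dZ = differential_section[OF U'(1) Z]
    have "Db (\<lambda>y. Db (\<lambda>y. ?F (\<phi> y)) y (Z y)) x w = Db (\<lambda>y. ?Q y (d\<phi> y (Z y))) x w"
      by (rule fun_cong[OF D_cong[OF U'(1) Q_section[OF U'(1) order_refl dZ] U'(2)]]) (simp add: DbF)
    also have "\<dots> = ?Q x (Db (\<lambda>y. d\<phi> y (Z y)) x w) + (Db (\<lambda>y. ?Q y (d\<phi> y (Z y))) x w - ?Q x (Db (\<lambda>y. d\<phi> y (Z y)) x w))"
      by simp
    also have "Db (\<lambda>y. ?Q y (d\<phi> y (Z y))) x w - ?Q x (Db (\<lambda>y. d\<phi> y (Z y)) x w)
        = Db (\<lambda>y. ?Q y (?E (d\<phi> x (Z x)) (\<phi> y))) x w - ?Q x (Db (\<lambda>y. ?E (d\<phi> x (Z x)) (\<phi> y)) x w)"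
      by (rule covariant_derivative_of_endomorphism_tensorial[OF U'(1) Q_linear Q_section U'(2) dZ
            frame[OF U'(1) order_refl]])
        (use N z in \<open>simp_all add: z_def[symmetric]\<close>)
    finally show ?thesis
      using Db_comp[OF W DE xM] Db_comp[OF W E xM] d(2) by (simp add: z_def)
  qed
  have Qz: "linear (DN ?F z)"
    using Q_linear[OF U'(2)] by (simp add: z_def)
  have "curv_op X Y V x = curv_op X Y (\<lambda>y. ?F (\<phi> y)) x"
    by (rule curv_op_tensorial[OF U'(1) X' Y' V' frame[OF U'(1) order_refl] U'(2)]) (use N z in \<open>simp add: z_def\<close>)
  also have "\<dots> = DN (\<lambda>y. DN ?F y (?E ?v y)) z ?u - DN (\<lambda>y. DN ?F y (?E ?u y)) z ?v
      - DN ?F z (DN (?E ?v) z ?u - DN (?E ?u) z ?v)"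
    unfolding curv_op_def second[OF X'] second[OF Y'] DbF[OF U'(2)]
      pullback_torsion_free[OF U'(1) X' Y' U'(2), symmetric]
    by (simp add: linear_diff[OF Qz] z_def[symmetric])
  \<comment> \<open>The last difference is the bracket of the two coordinate fields, as
    \<open>DN\<close> is torsion free.\<close>
  also have "\<dots> = curv N DN (?E ?u) (?E ?v) ?F z"
    using NN.torsion_free[OF W E E d(2), of ?v ?u] N z by (simp add: curv_def)
  finally show ?thesis
    by (simp add: curv_at_def z_def)
qed

end

section \<open>The curvature tensor of the target at a point\<close>

context pullback_setting
begin

text \<open>\<open>pullback_curvature\<close> for the identity map: its right-hand side sees only
  the values at \<open>z\<close>, which yields tensoriality in all three arguments at once.\<close>

lemma curv_pointwise:
  assumes "openin (mtop N) W" "X \<in> vector_fields N W" "Y \<in> vector_fields N W" "Z \<in> vector_fields N W" "z \<in> W"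
  shows "curv N DN X Y Z z = curv_at N DN z (X z) (Y z) (Z z)"
proof -
  interpret I: pullback_setting N N "\<lambda>x. x" DN DN
    by (rule pullback_setting_ident)
  have z: "z \<in> topspace (mtop N)"
    using assms(1,5) openin_subset by blast
  show ?thesis
    using I.pullback_curvature[OF assms(1-3) _ assms(5), of Z] assms(4)
    by (simp add: NN.sections_eq[OF assms(1)] NN.curv_eq_curv_op differential_ident[OF N z])
qed

lemma curv_at_skew:
  assumes z: "z \<in> topspace (mtop N)"
  shows "curv_at N DN z v u w = - curv_at N DN z u v w"
  unfolding curv_at_def
  by (rule NN.curv_skew[OF chart_dom_open[OF N chart_at_mem(1)[OF N z]]
        extend_vec_vector_field[OF z] extend_vec_vector_field[OF z] extend_vec_vector_field[OF z]
        chart_at_mem(2)[OF N z]])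

text \<open>A real combination of coordinate fields has the combined value at \<open>z\<close>, and
  by \<open>curv_pointwise\<close> only this value matters. The second argument follows from the
  first by skew symmetry.\<close>

lemma curv_at_linear:
  assumes z: "z \<in> topspace (mtop N)"
  shows "linear (\<lambda>u. curv_at N DN z u v w)" "linear (\<lambda>v. curv_at N DN z u v w)"
    "linear (\<lambda>w. curv_at N DN z u v w)"
proof -
  note d = chart_at_mem[OF N z]
  note W = chart_dom_open[OF N d(1)]
  let ?E = "extend_vec N z"
  note E = extend_vec_vector_field[OF z]
  have comb: "(\<lambda>y. r *\<^sub>R ?E a y + ?E b y) \<in> vector_fields N (chart_dom (chart_at N z))" for r a b
    using NN.section_add[OF W NN.section_const_scale[OF W, of "?E a" r], of "?E b"] E
    by (simp add: NN.sections_eq[OF W])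
  have 1: "linear (\<lambda>u. curv_at N DN z u v w)" for v w
  proof (rule linear_from_combination)
    fix r a b
    have "curv_at N DN z (r *\<^sub>R a + b) v w = curv N DN (\<lambda>y. r *\<^sub>R ?E a y + ?E b y) (?E v) (?E w) z"
      using curv_pointwise[OF W comb E E d(2)] N z by simp
    also have "\<dots> = r *\<^sub>R curv_at N DN z a v w + curv_at N DN z b v w"
      unfolding curv_at_def by (rule NN.curv_linear_left[OF W E E E E d(2)])
    finally show "curv_at N DN z (r *\<^sub>R a + b) v w = r *\<^sub>R curv_at N DN z a v w + curv_at N DN z b v w" .
  qed
  show "linear (\<lambda>u. curv_at N DN z u v w)"
    by (rule 1)
  have "linear (\<lambda>v. - curv_at N DN z v u w)"
    by (rule linear_compose_neg[OF 1])
  then show "linear (\<lambda>v. curv_at N DN z u v w)"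
    unfolding curv_at_skew[OF z, of u] by simp
  show "linear (\<lambda>w. curv_at N DN z u v w)"
  proof (rule linear_from_combination)
    fix r a b
    have "curv_at N DN z u v (r *\<^sub>R a + b) = curv N DN (?E u) (?E v) (\<lambda>y. r *\<^sub>R ?E a y + ?E b y) z"
      using curv_pointwise[OF W E E comb d(2)] N z by simp
    also have "\<dots> = r *\<^sub>R curv_at N DN z u v a + curv_at N DN z u v b"
      unfolding curv_at_def by (rule NN.curv_linear_right[OF W E E E E d(2)])
    finally show "curv_at N DN z u v (r *\<^sub>R a + b) = r *\<^sub>R curv_at N DN z u v a + curv_at N DN z u v b" .
  qed
qed

text \<open>\<open>curv_at\<close> extends its arguments in a chart that changes with the base
  point, so smoothness is not visible from the definition. On coordinate fields of one chart it
  equals the smooth field \<open>curv\<close>; the arguments are then generalised one by one by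
  linearity.\<close>

lemma curv_at_section:
  assumes U: "open_in U" and z: "z \<in> topspace (mtop N)" and sub: "\<phi> ` U \<subseteq> chart_dom (chart_at N z)"
    and V1: "V1 \<in> \<Gamma> U" and V2: "V2 \<in> \<Gamma> U" and V3: "V3 \<in> \<Gamma> U"
  shows "(\<lambda>y. curv_at N DN (\<phi> y) (V1 y) (V2 y) (V3 y)) \<in> \<Gamma> U"
proof -
  note W = chart_dom_open[OF N chart_at_mem(1)[OF N z]]
  note E = extend_vec_vector_field[OF z]
  have lin: "linear (\<lambda>u. curv_at N DN (\<phi> y) u v w)" "linear (\<lambda>v. curv_at N DN (\<phi> y) u v w)"
    "linear (\<lambda>w. curv_at N DN (\<phi> y) u v w)" if "y \<in> U" for y u v w
    using curv_at_linear smooth_map_topspace[OF \<phi>] openin_subset[OF U] that by blast+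
  let ?E = "extend_vec N z"
  let ?R = "\<lambda>y. curv_at N DN (\<phi> y)"
  have 0: "(\<lambda>y. ?R y (?E a (\<phi> y)) (?E b (\<phi> y)) (?E c (\<phi> y))) \<in> \<Gamma> U" for a b c
    by (rule section_cong[OF U compose_section[OF U W NN.curv_vector_field[OF W E E E] sub]])
      (use curv_pointwise[OF W E E E] sub in blast)
  have 1: "(\<lambda>y. ?R y (V1 y) (?E b (\<phi> y)) (?E c (\<phi> y))) \<in> \<Gamma> U" for b c
    by (rule pointwise_linear_section[where L = "\<lambda>y u. ?R y u (?E b (\<phi> y)) (?E c (\<phi> y))",
          OF U lin(1) z sub 0 V1])
  have 2: "(\<lambda>y. ?R y (V1 y) (V2 y) (?E c (\<phi> y))) \<in> \<Gamma> U" for c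
    by (rule pointwise_linear_section[where L = "\<lambda>y u. ?R y (V1 y) u (?E c (\<phi> y))",
          OF U lin(2) z sub 1 V2])
  show ?thesis
    by (rule pointwise_linear_section[where L = "\<lambda>y u. ?R y (V1 y) (V2 y) u", OF U lin(3) z sub 2 V3])
qed

text \<open>With two arguments fixed, the curvature is an endomorphism of the pull-back bundle with
  tensorial covariant derivative. So each argument in turn can be replaced by a coordinate field
  with the same value at \<open>x\<close>, without changing the defect in the product rule.\<close>

lemma pullback_curv_Leibniz:
  assumes U: "open_in U" and V1: "V1 \<in> \<Gamma> U" and V2: "V2 \<in> \<Gamma> U" and V3: "V3 \<in> \<Gamma> U" and x: "x \<in> U"
  shows "Db (\<lambda>y. curv_at N DN (\<phi> y) (V1 y) (V2 y) (V3 y)) x v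
    = nabla_curv_at N DN (\<phi> x) (d\<phi> x v) (V1 x) (V2 x) (V3 x)
      + curv_at N DN (\<phi> x) (Db V1 x v) (V2 x) (V3 x)
      + curv_at N DN (\<phi> x) (V1 x) (Db V2 x v) (V3 x)
      + curv_at N DN (\<phi> x) (V1 x) (V2 x) (Db V3 x v)"
proof -
  define z where "z = \<phi> x"
  define d where "d = chart_at N z"
  define U' where "U' = U \<inter> \<phi> -` chart_dom d"
  have U': "open_in U'" "x \<in> U'" "U' \<subseteq> U" and z: "z \<in> topspace (mtop N)" and xM: "x \<in> topspace (mtop M)"
    using open_in_preimage_chart[OF U x] by (auto simp: U'_def z_def d_def)
  have sub: "\<phi> ` U'' \<subseteq> chart_dom (chart_at N z)" if "U'' \<subseteq> U'" for U''
    using that by (auto simp: U'_def d_def)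
  have d: "d \<in> atlas N" "z \<in> chart_dom d"
    using chart_at_mem[OF N z] by (simp_all add: d_def)
  note W = chart_dom_open[OF N d(1)]
  have V1': "V1 \<in> \<Gamma> U''" and V2': "V2 \<in> \<Gamma> U''" and V3': "V3 \<in> \<Gamma> U''" if "U'' \<subseteq> U'" for U''
    using section_subset[OF V1] section_subset[OF V2] section_subset[OF V3] that U'(3) by auto
  let ?E = "extend_vec N z"
  have E: "?E w \<in> vector_fields N (chart_dom d)" for w
    using extend_vec_vector_field[OF z] by (simp add: d_def)
  have frame: "(\<lambda>y. ?E w (\<phi> y)) \<in> \<Gamma> U''" if "open_in U''" "U'' \<subseteq> U'" for w U''
    by (rule extend_vec_section[OF that(1) z sub[OF that(2)]])
  note frame' = frame[OF U'(1) order_refl]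
  have frame_x: "W x = ?E (W x) (\<phi> x)" for W
    using N z by (simp add: z_def)
  let ?R = "\<lambda>y. curv_at N DN (\<phi> y)"
  have lin: "linear (\<lambda>u. ?R y u v w)" "linear (\<lambda>v. ?R y u v w)" "linear (\<lambda>w. ?R y u v w)"
    if "y \<in> U'" for y u v w
    using curv_at_linear smooth_map_topspace[OF \<phi>] openin_subset[OF U'(1)] that by blast+
  let ?e1 = "\<lambda>y. ?E (V1 x) (\<phi> y)" and ?e2 = "\<lambda>y. ?E (V2 x) (\<phi> y)" and ?e3 = "\<lambda>y. ?E (V3 x) (\<phi> y)"
  note R_section = curv_at_section[OF _ z sub]
  have "Db (\<lambda>y. ?R y (V1 y) (V2 y) (V3 y)) x v - ?R x (Db V1 x v) (V2 x) (V3 x)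
      = Db (\<lambda>y. ?R y (?e1 y) (V2 y) (V3 y)) x v - ?R x (Db ?e1 x v) (V2 x) (V3 x)"
    by (rule covariant_derivative_of_endomorphism_tensorial[where L = "\<lambda>y u. ?R y u (V2 y) (V3 y)",
          OF U'(1) _ _ U'(2) V1'[OF order_refl] frame'[of "V1 x"] frame_x[of V1]])
      (auto intro: lin R_section V2' V3')
  moreover have "Db (\<lambda>y. ?R y (?e1 y) (V2 y) (V3 y)) x v - ?R x (?e1 x) (Db V2 x v) (V3 x)
      = Db (\<lambda>y. ?R y (?e1 y) (?e2 y) (V3 y)) x v - ?R x (?e1 x) (Db ?e2 x v) (V3 x)"
    by (rule covariant_derivative_of_endomorphism_tensorial[where L = "\<lambda>y u. ?R y (?e1 y) u (V3 y)",
          OF U'(1) _ _ U'(2) V2'[OF order_refl] frame'[of "V2 x"] frame_x[of V2]])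
      (auto intro: lin R_section frame V3')
  moreover have "Db (\<lambda>y. ?R y (?e1 y) (?e2 y) (V3 y)) x v - ?R x (?e1 x) (?e2 x) (Db V3 x v)
      = Db (\<lambda>y. ?R y (?e1 y) (?e2 y) (?e3 y)) x v - ?R x (?e1 x) (?e2 x) (Db ?e3 x v)"
    by (rule covariant_derivative_of_endomorphism_tensorial[where L = "\<lambda>y u. ?R y (?e1 y) (?e2 y) u",
          OF U'(1) _ _ U'(2) V3'[OF order_refl] frame'[of "V3 x"] frame_x[of V3]])
      (auto intro: lin R_section frame)
  \<comment> \<open>On coordinate fields every pull-back derivative becomes a \<open>DN\<close>
    derivative in direction \<open>d\<phi> x v\<close>, and the formula is the definition of
    \<open>nabla_curv\<close> together with \<open>curv_pointwise\<close>.\<close>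
  moreover have "Db (\<lambda>y. ?R y (?e1 y) (?e2 y) (?e3 y)) x v
      = nabla_curv_at N DN z (d\<phi> x v) (V1 x) (V2 x) (V3 x)
        + ?R x (Db ?e1 x v) (V2 x) (V3 x) + ?R x (V1 x) (Db ?e2 x v) (V3 x) + ?R x (V1 x) (V2 x) (Db ?e3 x v)"
  proof -
    let ?C = "curv N DN (?E (V1 x)) (?E (V2 x)) (?E (V3 x))" and ?t = "d\<phi> x v"
    have C: "?C \<in> vector_fields N (chart_dom d)"
      by (rule NN.curv_vector_field[OF W E E E])
    have DE: "(\<lambda>y. DN (?E w) y (?E w' y)) \<in> vector_fields N (chart_dom d)" for w w'
      using NN.D_section[OF W, of "?E w" "?E w'"] E NN.sections_eq[OF W] by simp
    have "Db (\<lambda>y. ?R y (?e1 y) (?e2 y) (?e3 y)) x = Db (\<lambda>y. ?C (\<phi> y)) x"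
      using sub[OF order_refl] curv_pointwise[OF W E E E]
      by (intro D_cong[OF U'(1) compose_section[OF U'(1) W C] U'(2)]) (auto simp: d_def)
    then have "Db (\<lambda>y. ?R y (?e1 y) (?e2 y) (?e3 y)) x v = DN ?C z ?t"
      using Db_comp[OF W C xM] d(2) by (simp add: z_def)
    moreover have "Db (\<lambda>y. ?E w (\<phi> y)) x v = DN (?E w) z ?t" for w
      using Db_comp[OF W E xM] d(2) by (simp add: z_def)
    moreover have "nabla_curv_at N DN z ?t (V1 x) (V2 x) (V3 x)
      = DN ?C z ?t - curv_at N DN z (DN (?E (V1 x)) z ?t) (V2 x) (V3 x)
        - curv_at N DN z (V1 x) (DN (?E (V2 x)) z ?t) (V3 x)
        - curv_at N DN z (V1 x) (V2 x) (DN (?E (V3 x)) z ?t)"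
      unfolding nabla_curv_at_def nabla_curv_def curv_pointwise[OF W DE E E d(2)]
        curv_pointwise[OF W E DE E d(2)] curv_pointwise[OF W E E DE d(2)]
      using N z by simp
    ultimately show ?thesis
      by (simp add: z_def)
  qed
  ultimately show ?thesis
    using frame_x by (simp add: z_def algebra_simps)
qed

end

section \<open>The Ricci identity for the second fundamental form\<close>

locale chern_federer_setting = pullback_setting M N \<phi> DN Db + MM: torsion_free_connection M DM
  for M :: "('a, 'e::euclidean_space, 'y) manifold_scheme"
    and N :: "('b, 'f::euclidean_space, 'z) manifold_scheme"
    and \<phi> :: "'a \<Rightarrow> 'b"
    and DM :: "('a \<Rightarrow> 'e) \<Rightarrow> 'a \<Rightarrow> 'e \<Rightarrow> 'e"
    and DN :: "('b \<Rightarrow> 'f) \<Rightarrow> 'b \<Rightarrow> 'f \<Rightarrow> 'f"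
    and Db :: "('a \<Rightarrow> 'f) \<Rightarrow> 'a \<Rightarrow> 'e \<Rightarrow> 'f"
begin

abbreviation "B \<equiv> nabla_d M N \<phi> DM Db"
abbreviation "B2 \<equiv> nabla2_d M N \<phi> DM Db"
abbreviation "B3 \<equiv> nabla3_d M N \<phi> DM Db"
abbreviation "RN y \<equiv> curv_at N DN (\<phi> y)"

lemma DM_vector_field: "open_in U \<Longrightarrow> X \<in> \<XX> U \<Longrightarrow> Y \<in> \<XX> U \<Longrightarrow> (\<lambda>y. DM Y y (X y)) \<in> \<XX> U"
  using MM.D_section[of U Y X] by (simp add: MM.sections_eq)

lemma nabla_d_section:
  assumes U: "open_in U" and X: "X \<in> \<XX> U" and Y: "Y \<in> \<XX> U"
  shows "B X Y \<in> \<Gamma> U"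
  using section_diff[OF U D_section[OF U differential_section[OF U Y] X]
      differential_section[OF U DM_vector_field[OF U X Y]]]
  unfolding nabla_d_def .

lemma nabla2_d_section:
  assumes U: "open_in U" and X: "X \<in> \<XX> U" and Y: "Y \<in> \<XX> U" and Z: "Z \<in> \<XX> U"
  shows "B2 X Y Z \<in> \<Gamma> U"
  using section_diff[OF U section_diff[OF U D_section[OF U nabla_d_section[OF U Y Z] X]
        nabla_d_section[OF U DM_vector_field[OF U X Y] Z]]
      nabla_d_section[OF U Y DM_vector_field[OF U X Z]]]
  unfolding nabla2_d_def .

text \<open>Exchanging the arguments changes the pull-back derivative by the image of the bracket
  and the \<open>DM\<close> term by the same amount.\<close>

lemma nabla_d_symmetric:
  assumes U: "open_in U" and X: "X \<in> \<XX> U" and Y: "Y \<in> \<XX> U" and x: "x \<in> U"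
  shows "B X Y x = B Y X x"
proof -
  have "linear (d\<phi> x)"
    using d\<phi>_linear openin_subset[OF U] x by blast
  from linear_diff[OF this, of "DM Y x (X x)" "DM X x (Y x)"] show ?thesis
    using pullback_torsion_free[OF U X Y x] MM.torsion_free[OF U X Y x] by (simp add: nabla_d_def algebra_simps)
qed

text \<open>\<open>W\<close> only enters through \<open>d\<phi> W\<close> and its derivatives. The
  mixed terms, where \<open>Db\<close> acts on the image of a \<open>DM\<close> derivative of
  \<open>W\<close>, cancel between the two orders. The terms from differentiating \<open>Y\<close>
  and \<open>Z\<close> combine, by torsion freeness, to the bracket terms of both
  curvatures.\<close>

lemma Ricci_identity:
  assumes U: "open_in U" and Y: "Y \<in> \<XX> U" and Z: "Z \<in> \<XX> U" and W: "W \<in> \<XX> U" and x: "x \<in> U"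
  shows "B2 Y Z W x - B2 Z Y W x
    = RN x (d\<phi> x (Y x)) (d\<phi> x (Z x)) (d\<phi> x (W x)) - d\<phi> x (curv M DM Y Z W x)"
proof -
  have lin: "linear (d\<phi> x)"
    using d\<phi>_linear openin_subset[OF U] x by blast
  note dW = differential_section[OF U W]
  have second: "Db (B S W) x v = Db (\<lambda>y. Db (\<lambda>y. d\<phi> y (W y)) y (S y)) x v - Db (\<lambda>y. d\<phi> y (DM W y (S y))) x v"
    if S: "S \<in> \<XX> U" for S v
    unfolding nabla_d_def
    by (rule D_diff[OF U D_section[OF U dW S] differential_section[OF U DM_vector_field[OF U S W]] x])
  have Wlin: "linear (DM W x)" and dWlin: "linear (Db (\<lambda>y. d\<phi> y (W y)) x)"
    using MM.D_linear[OF U _ x] W D_linear[OF U dW x] by (simp_all add: MM.sections_eq[OF U])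
  have "curv_op Y Z (\<lambda>y. d\<phi> y (W y)) x = RN x (d\<phi> x (Y x)) (d\<phi> x (Z x)) (d\<phi> x (W x))"
    by (rule pullback_curvature[OF U Y Z dW x])
  then show ?thesis
    unfolding nabla2_d_def second[OF Y] second[OF Z]
    unfolding nabla_d_def curv_op_def curv_def MM.torsion_free[OF U Y Z x, symmetric]
    by (simp add: linear_diff[OF lin] linear_add[OF lin] linear_diff[OF Wlin] linear_diff[OF dWlin] algebra_simps)
qed

text \<open>The Ricci identity is differentiated along \<open>X\<close>, and its instances with
  \<open>Y\<close>, \<open>Z\<close> or \<open>W\<close> replaced by the \<open>DM\<close>
  derivative along \<open>X\<close> are subtracted. The derivative of \<open>d\<phi> V\<close> along
  \<open>X\<close> is \<open>B X V\<close> plus the image of the derivative of \<open>V\<close>; the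
  latter parts cancel against those instances, and the values of \<open>B\<close> stay.\<close>

lemma nabla3_d_commute:
  assumes U: "open_in U" and X: "X \<in> \<XX> U" and Y: "Y \<in> \<XX> U" and Z: "Z \<in> \<XX> U" and W: "W \<in> \<XX> U" and x: "x \<in> U"
  shows "B3 X Y Z W x - B3 X Z Y W x
    = nabla_curv_at N DN (\<phi> x) (d\<phi> x (X x)) (d\<phi> x (Y x)) (d\<phi> x (Z x)) (d\<phi> x (W x))
      + RN x (B X Y x) (d\<phi> x (Z x)) (d\<phi> x (W x)) + RN x (d\<phi> x (Y x)) (B X Z x) (d\<phi> x (W x))
      + RN x (d\<phi> x (Y x)) (d\<phi> x (Z x)) (B X W x)
      - B X (curv M DM Y Z W) x - d\<phi> x (nabla_curv M DM X Y Z W x)"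
proof -
  define U' where "U' = U \<inter> \<phi> -` chart_dom (chart_at N (\<phi> x))"
  have U': "open_in U'" "x \<in> U'" "U' \<subseteq> U" and z: "\<phi> x \<in> topspace (mtop N)" and xM: "x \<in> topspace (mtop M)"
    using open_in_preimage_chart[OF U x] by (auto simp: U'_def)
  have sub: "\<phi> ` U' \<subseteq> chart_dom (chart_at N (\<phi> x))"
    by (auto simp: U'_def)
  note X' = vector_fields_subset[OF X U'(3)] and Y' = vector_fields_subset[OF Y U'(3)]
    and Z' = vector_fields_subset[OF Z U'(3)] and W' = vector_fields_subset[OF W U'(3)]
  note d = differential_section[OF U'(1)]
  note DM' = DM_vector_field[OF U'(1) X']
  note ricci = Ricci_identity[OF U'(1)]
  let ?K = "\<lambda>y. RN y (d\<phi> y (Y y)) (d\<phi> y (Z y)) (d\<phi> y (W y))"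
  note K = curv_at_section[OF U'(1) z sub d[OF Y'] d[OF Z'] d[OF W']]
  note C = d[OF MM.curv_vector_field[OF U'(1) Y' Z' W']]
  note n2 = nabla2_d_section[OF U'(1) Y' Z' W'] nabla2_d_section[OF U'(1) Z' Y' W']
  have split: "Db (\<lambda>y. d\<phi> y (V y)) x (X x) = B X V x + d\<phi> x (DM V x (X x))" for V
    by (simp add: nabla_d_def)
  have "Db (B2 Y Z W) x (X x) - Db (B2 Z Y W) x (X x) = Db (\<lambda>y. B2 Y Z W y - B2 Z Y W y) x (X x)"
    by (rule D_diff[OF U'(1) n2 U'(2), symmetric])
  also have "\<dots> = Db (\<lambda>y. ?K y - d\<phi> y (curv M DM Y Z W y)) x (X x)"
    by (rule fun_cong[OF D_cong[OF U'(1) section_diff[OF U'(1) K C] U'(2)]]) (rule ricci[OF Y' Z' W'])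
  also have "\<dots> = Db ?K x (X x) - Db (\<lambda>y. d\<phi> y (curv M DM Y Z W y)) x (X x)"
    by (rule D_diff[OF U'(1) K C U'(2)])
  finally have main: "Db (B2 Y Z W) x (X x) - Db (B2 Z Y W) x (X x)
      = Db ?K x (X x) - (B X (curv M DM Y Z W) x + d\<phi> x (DM (curv M DM Y Z W) x (X x)))"
    unfolding split .
  note lin = curv_at_linear[OF z]
  have Leibniz: "Db ?K x (X x)
    = nabla_curv_at N DN (\<phi> x) (d\<phi> x (X x)) (d\<phi> x (Y x)) (d\<phi> x (Z x)) (d\<phi> x (W x))
      + (RN x (B X Y x) (d\<phi> x (Z x)) (d\<phi> x (W x)) + RN x (d\<phi> x (DM Y x (X x))) (d\<phi> x (Z x)) (d\<phi> x (W x)))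
      + (RN x (d\<phi> x (Y x)) (B X Z x) (d\<phi> x (W x)) + RN x (d\<phi> x (Y x)) (d\<phi> x (DM Z x (X x))) (d\<phi> x (W x)))
      + (RN x (d\<phi> x (Y x)) (d\<phi> x (Z x)) (B X W x) + RN x (d\<phi> x (Y x)) (d\<phi> x (Z x)) (d\<phi> x (DM W x (X x))))"
    unfolding pullback_curv_Leibniz[OF U'(1) d[OF Y'] d[OF Z'] d[OF W'] U'(2)] split
      linear_add[OF lin(1)] linear_add[OF lin(2)] linear_add[OF lin(3)] ..
  \<comment> \<open>Each identity is solved for the term in the order \<open>Y\<close>,
    \<open>Z\<close>, so that rewriting leaves only terms in the order \<open>Z\<close>,
    \<open>Y\<close>, which then cancel.\<close>
  note eqs = main[unfolded diff_eq_eq] ricci[OF DM'[OF Y'] Z' W' U'(2), unfolded diff_eq_eq]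
    ricci[OF Y' DM'[OF Z'] W' U'(2), unfolded diff_eq_eq] ricci[OF Y' Z' DM'[OF W'] U'(2), unfolded diff_eq_eq]
  show ?thesis
    unfolding nabla3_d_def nabla_curv_def linear_diff[OF d\<phi>_linear[OF xM]] eqs Leibniz
    by (simp add: algebra_simps)
qed

text \<open>Each factor 2 has two sources: one copy of the curvature term comes from
  \<open>nabla3_d_commute\<close>, the other from \<open>W2\<close> and \<open>W1\<close>
  themselves. The copy from \<open>W1\<close> enters with a minus sign, which the skew symmetry of
  the curvature absorbs.\<close>

lemma W2_minus_W1:
  fixes e :: "nat \<Rightarrow> 'a \<Rightarrow> 'e"
  assumes U: "open_in U" and e: "\<And>i. i \<in> {1..DIM('e)} \<Longrightarrow> e i \<in> \<XX> U" and x: "x \<in> U"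
  shows "W2 p M N \<phi> DM DN Db e x - W1 p M N \<phi> DM DN Db e x
    = (\<Sum>i=1..DIM('e). \<Sum>j=1..DIM('e). (frame_sign p i * frame_sign p j) *\<^sub>R
        (nabla_curv_at N DN (\<phi> x) (d\<phi> x (e i x)) (d\<phi> x (e i x)) (d\<phi> x (e j x)) (d\<phi> x (e j x))
         - B (e i) (curv M DM (e i) (e j) (e j)) x
         - d\<phi> x (nabla_curv M DM (e i) (e i) (e j) (e j) x)
         + 2 *\<^sub>R RN x (B (e i) (e i) x) (d\<phi> x (e j x)) (d\<phi> x (e j x))
         + 2 *\<^sub>R RN x (d\<phi> x (e i x)) (B (e i) (e j) x) (d\<phi> x (e j x))))"
    (is "_ = (\<Sum>i=1..DIM('e). \<Sum>j=1..DIM('e). ?s i j *\<^sub>R ?T i j)")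
proof -
  let ?I = "{1..DIM('e)}"
  have z: "\<phi> x \<in> topspace (mtop N)"
    using open_in_preimage_chart[OF U x] by simp
  let ?S = "\<lambda>i j. RN x (d\<phi> x (e i x)) (d\<phi> x (e j x)) (B (e i) (e j) x)"
  \<comment> \<open>Exchanging \<open>i\<close> and \<open>j\<close> keeps the sign product and, by
    \<open>nabla_d_symmetric\<close>, the last argument, but flips the curvature; the trace
    therefore equals its own negative.\<close>
  have "?s i j *\<^sub>R ?S i j = - (?s j i *\<^sub>R ?S j i)" if "i \<in> ?I" "j \<in> ?I" for i j
    using nabla_d_symmetric[OF U e[OF that(1)] e[OF that(2)] x]
      curv_at_skew[OF z, of "d\<phi> x (e i x)" "d\<phi> x (e j x)"] by (simp add: mult.commute)
  then have "(\<Sum>i\<in>?I. \<Sum>j\<in>?I. ?s i j *\<^sub>R ?S i j) = (\<Sum>i\<in>?I. \<Sum>j\<in>?I. - (?s j i *\<^sub>R ?S j i))"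
    by (intro sum.cong refl)
  also have "\<dots> = - (\<Sum>j\<in>?I. \<Sum>i\<in>?I. ?s j i *\<^sub>R ?S j i)"
    by (subst sum.swap) (simp add: sum_negf)
  finally have "(\<Sum>i\<in>?I. \<Sum>j\<in>?I. ?s i j *\<^sub>R ?S i j) + (\<Sum>i\<in>?I. \<Sum>j\<in>?I. ?s i j *\<^sub>R ?S i j) = 0"
    unfolding eq_neg_iff_add_eq_0 .
  then have "2 *\<^sub>R (\<Sum>i\<in>?I. \<Sum>j\<in>?I. ?s i j *\<^sub>R ?S i j) = 0"
    unfolding scaleR_2 .
  then have trace: "(\<Sum>i\<in>?I. \<Sum>j\<in>?I. ?s i j *\<^sub>R ?S i j) = 0"
    by simp
  have "?s i j *\<^sub>R (B3 (e i) (e i) (e j) (e j) x + RN x (B (e i) (e i) x) (d\<phi> x (e j x)) (d\<phi> x (e j x)))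
      - ?s i j *\<^sub>R (B3 (e i) (e j) (e i) (e j) x + RN x (B (e i) (e j) x) (d\<phi> x (e i x)) (d\<phi> x (e j x)))
      = ?s i j *\<^sub>R ?T i j + ?s i j *\<^sub>R ?S i j" if "i \<in> ?I" "j \<in> ?I" for i j
  proof -
    note ei = e[OF that(1)] and ej = e[OF that(2)]
    have "B3 (e i) (e i) (e j) (e j) x + RN x (B (e i) (e i) x) (d\<phi> x (e j x)) (d\<phi> x (e j x))
      - (B3 (e i) (e j) (e i) (e j) x + RN x (B (e i) (e j) x) (d\<phi> x (e i x)) (d\<phi> x (e j x)))
      = ?T i j + ?S i j"
      using nabla3_d_commute[OF U ei ei ej ej x]
        curv_at_skew[OF z, of "B (e i) (e j) x" "d\<phi> x (e i x)" "d\<phi> x (e j x)"]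
      by (simp add: scaleR_2 algebra_simps)
    then show ?thesis
      unfolding scaleR_diff_right[symmetric] scaleR_add_right[symmetric] by simp
  qed
  then have "W2 p M N \<phi> DM DN Db e x - W1 p M N \<phi> DM DN Db e x
      = (\<Sum>i\<in>?I. \<Sum>j\<in>?I. ?s i j *\<^sub>R ?T i j + ?s i j *\<^sub>R ?S i j)"
    unfolding W1_def W2_def sum_subtractf[symmetric] by (intro sum.cong refl)
  then show ?thesis
    by (simp only: sum.distrib trace add_0_right)
qed

end

lemma levi_civita_torsion_free_connection:
  assumes "smooth_manifold M" "levi_civita M D"
  shows "torsion_free_connection M D"
  using assms by unfold_locales (auto simp: levi_civita_def)

theorem proposition4p4:
  fixes M :: "('a, 'e::euclidean_space) metric_manifold"
    and N :: "('b, 'f::euclidean_space) metric_manifold"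
    and \<phi> :: "'a \<Rightarrow> 'b"
    and p q :: nat
    and DM :: "('a \<Rightarrow> 'e) \<Rightarrow> 'a \<Rightarrow> 'e \<Rightarrow> 'e"
    and DN :: "('b \<Rightarrow> 'f) \<Rightarrow> 'b \<Rightarrow> 'f \<Rightarrow> 'f"
    and Db :: "('a \<Rightarrow> 'f) \<Rightarrow> 'a \<Rightarrow> 'e \<Rightarrow> 'f"
  assumes "pseudo_riemannian p M"
    and "pseudo_riemannian q N"
    and "smooth_map M N \<phi>"
    and "levi_civita M DM"
    and "levi_civita N DN"
    and "pullback_connection M N \<phi> DN Db"
  shows "chern_federer_map p M N \<phi> DM DN Db \<longleftrightarrow>
    (\<forall>U e. orthonormal_frame p M U e \<longrightarrow> (\<forall>x\<in>U.
      0 = (\<Sum>i=1..DIM('e). \<Sum>j=1..DIM('e). (frame_sign p i * frame_sign p j) *\<^sub>R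
        (nabla_curv_at N DN (\<phi> x) (differential M N \<phi> x (e i x)) (differential M N \<phi> x (e i x))
            (differential M N \<phi> x (e j x)) (differential M N \<phi> x (e j x))
         - nabla_d M N \<phi> DM Db (e i) (curv M DM (e i) (e j) (e j)) x
         - differential M N \<phi> x (nabla_curv M DM (e i) (e i) (e j) (e j) x)
         + 2 *\<^sub>R curv_at N DN (\<phi> x) (nabla_d M N \<phi> DM Db (e i) (e i) x)
             (differential M N \<phi> x (e j x)) (differential M N \<phi> x (e j x))
         + 2 *\<^sub>R curv_at N DN (\<phi> x) (differential M N \<phi> x (e i x))
             (nabla_d M N \<phi> DM Db (e i) (e j) x) (differential M N \<phi> x (e j x))))))"
proof -
  have M: "smooth_manifold M" and N: "smooth_manifold N"
    using assms(1,2) by (simp_all add: pseudo_riemannian_def)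
  interpret MM: torsion_free_connection M DM
    by (rule levi_civita_torsion_free_connection[OF M assms(4)])
  interpret NN: torsion_free_connection N DN
    by (rule levi_civita_torsion_free_connection[OF N assms(5)])
  interpret chern_federer_setting M N \<phi> DM DN Db
    by unfold_locales (use M N assms(3,6) in auto)
  have "W2 p M N \<phi> DM DN Db e x - W1 p M N \<phi> DM DN Db e x
    = (\<Sum>i=1..DIM('e). \<Sum>j=1..DIM('e). (frame_sign p i * frame_sign p j) *\<^sub>R
        (nabla_curv_at N DN (\<phi> x) (d\<phi> x (e i x)) (d\<phi> x (e i x)) (d\<phi> x (e j x)) (d\<phi> x (e j x))
         - B (e i) (curv M DM (e i) (e j) (e j)) x
         - d\<phi> x (nabla_curv M DM (e i) (e i) (e j) (e j) x)
         + 2 *\<^sub>R RN x (B (e i) (e i) x) (d\<phi> x (e j x)) (d\<phi> x (e j x))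
         + 2 *\<^sub>R RN x (d\<phi> x (e i x)) (B (e i) (e j) x) (d\<phi> x (e j x))))" (is "_ = ?T e x")
    if "orthonormal_frame p M U e" "x \<in> U" for U e x
    using that by (intro W2_minus_W1[of U]) (auto simp: orthonormal_frame_def)
  then have "W2 p M N \<phi> DM DN Db e x - W1 p M N \<phi> DM DN Db e x = 0 \<longleftrightarrow> 0 = ?T e x"
    if "orthonormal_frame p M U e" "x \<in> U" for U e x
    using that by (simp only: eq_commute)
  then show ?thesis
    unfolding chern_federer_map_def using assms(3) by blast
qed

end
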